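(* Let $A$ and $B$ be independent, $(A_n,B_n)_{n\in\mathbb N}$ i.i.d. copies of $(A,B)$, $X=\sum_{k\ge1}\Pi_{k-1}B_k$. Assume that $A$ has the $\beta(\lambda,1)$ distribution for some $\lambda>0$ (density $\lambda x^{\lambda-1}$ on $(0,1)$), that $\mathbb E\log(1+B^-)<\infty$, and that $$\mathbb P\{B>x\}=Ce^{-bx}+r(x),\quad x\ge0,$$ for some $C,b>0$ and a function $r$ with $\lim_{x\to\infty}e^{bx}r(x)=0$, $$\int_1^\infty\frac{e^{by}}{y}r^+(y)\,dy<\infty\quad\text{and}\quad\int_1^\infty\frac{e^{(b+\varepsilon)y}}{y}r^-(y)\,dy<\infty$$ for some $\varepsilon>0$. Then $$\mathbb P\{X>x\}\sim Kx^{\lambda C}e^{-bx},\quad x\to\infty,$$ where $$K:=\frac{Cb^{C\lambda}}{\Gamma(C\lambda+1)}\exp\Big(\lambda\Big[\int_0^\infty\frac{e^{by}-1}{y}r(y)\,dy-\int_{-\infty}^0\frac{e^{by}-1}{y}\mathbb P\{B\le y\}\,dy\Big]\Big)<\infty.$$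
   Context: $\Pi_0:=1$, $\Pi_n:=A_1\cdots A_n$; $x^+:=\max(x,0)$, $x^-:=-\min(x,0)$; $\Gamma$ is the Euler gamma function. *)

theory Defs
  imports "HOL-Probability.Probability"
begin

text \<open>The perpetuity X = sum_{k>=1} Pi_{k-1} B_k, with the i.i.d. copies indexed from 0:
  (A 0, B 0) plays the role of (A_1, B_1).\<close>
definition perpetuity :: "(nat \<Rightarrow> 'a \<Rightarrow> real) \<Rightarrow> (nat \<Rightarrow> 'a \<Rightarrow> real) \<Rightarrow> 'a \<Rightarrow> real" where
  "perpetuity A B \<omega> = (\<Sum>k. (\<Prod>i<k. A i \<omega>) * B k \<omega>)"

end

theory Submission
  imports Defs
begin

text \<open>
  Write \<open>X = B\<^sub>1 + Y\<close>, where \<open>B\<^sub>1\<close> is independent of \<open>Y\<close> and \<open>Y\<close> is distributed as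
  \<open>A X\<close>. For beta-distributed \<open>A\<close> the resulting fixed-point equation of the moment generating
  function \<open>\<phi>\<close> of \<open>Y\<close> is the linear differential equation
  \<open>u \<phi>'(u) = \<lambda> (E exp(u B) - 1) \<phi>(u)\<close>, whose solution behaves like a constant times
  \<open>(b - u) powr (-\<lambda> C)\<close> as \<open>u\<close> tends to \<open>b\<close>. Karamata's Tauberian theorem turns this into the
  growth of \<open>G(x) = E[exp(b Y); 0 \<le> Y \<le> x]\<close>, namely a constant times \<open>x powr (\<lambda> C)\<close>. Since
  \<open>P(B > u)\<close> is close to \<open>C exp(-b u)\<close>, conditioning on \<open>Y\<close> gives
  \<open>P(X > x) \<sim> C exp(-b x) G(x)\<close>: the errors come from the increments \<open>G(x) - G(x - m)\<close> and from
  \<open>P(Y > x)\<close>, both of which are negligible because \<open>G\<close> is regularly varying.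
\<close>

section \<open>Karamata's Tauberian theorem\<close>

text \<open>The constant is read off from the pole of the moment generating function of
  \<open>B 0\<close>: \<open>(E exp(t B) - 1) / t\<close> equals \<open>C / (b - t)\<close> plus the
  integral of \<open>exp (t * y) * tail_defect M C b y\<close>. Integrating over
  \<open>(0, u)\<close>, the pole yields \<open>(b / (b - u)) powr (lam * C)\<close> and the rest
  yields \<open>defect_exponent u\<close>, which stays finite at \<open>u = b\<close> and there
  becomes the bracket in the exponential. The factor \<open>Gamma (C * lam + 1)\<close> is
  contributed by Karamata. The differential equation is singular at 0, so its free constant is fixed
  by the limit 1 of the transform at 0 from the right. Two obstacles shape the rest. The transform
  of \<open>Y\<close> must first be known to be finite on \<open>(0, b)\<close>; this is proved for
  partial sums with an explicit majorant and passed to the limit by Fatou. Moreover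
  \<open>exp (b * Y)\<close> has infinite mean, so values of \<open>Y\<close> of every size up to
  \<open>x\<close> contribute to \<open>P(X > x)\<close>; this is why a truncated moment, and with
  it a Tauberian theorem, is required.\<close>

definition gamma_measure :: "real \<Rightarrow> real measure" where
  "gamma_measure a = density lborel (\<lambda>t. ennreal (indicator {0..} t * t powr (a - 1) / Gamma a))"

lemma sets_gamma_measure [measurable_cong, simp]: "sets (gamma_measure a) = sets borel"
  by (simp add: gamma_measure_def)

lemma AE_gamma_measure: "AE t in gamma_measure a. 0 \<le> t"
  unfolding gamma_measure_def by (subst AE_density) (auto split: split_indicator)

text \<open>The substitution \<open>t -> c * t\<close> in Euler's integral. A measure with transform
  exactly \<open>c powr - a\<close> is the model case of the Tauberian hypothesis with
  \<open>K = 1\<close>, and its mass on \<open>{..z}\<close> is where \<open>Gamma (a + 1)\<close>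
  comes from.\<close>

lemma gamma_measure_exp:
  fixes a c :: real
  assumes a: "a > 0" and c: "c > 0"
  shows "has_bochner_integral (gamma_measure a) (\<lambda>t. exp (- c * t)) (c powr - a)"
proof -
  have G: "Gamma a > 0" using a by (rule Gamma_real_pos)
  have "ennreal (Gamma a) = (\<integral>\<^sup>+t. ennreal (indicator {0..} t * t powr (a - 1) / exp t) \<partial>lborel)"
    using a by (rule Gamma_conv_nn_integral_real)
  also have "\<dots> = c * (\<integral>\<^sup>+t. ennreal (indicator {0..} (c * t) * (c * t) powr (a - 1) / exp (c * t)) \<partial>lborel)"
    using c by (subst nn_integral_real_affine[where c = c and t = 0]) (auto simp: abs_of_pos)
  also have "\<dots> = c * (\<integral>\<^sup>+t. ennreal (Gamma a * c powr (a - 1)) *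
      ennreal (indicator {0..} t * t powr (a - 1) / Gamma a * exp (- c * t)) \<partial>lborel)"
    using c G by (intro arg_cong2[where f = "(*)"] nn_integral_cong refl)
      (auto simp: ennreal_mult'[symmetric] powr_mult exp_minus field_simps zero_le_mult_iff split: split_indicator)
  also have "\<dots> = ennreal (Gamma a * c powr a) *
      (\<integral>\<^sup>+t. ennreal (indicator {0..} t * t powr (a - 1) / Gamma a * exp (- c * t)) \<partial>lborel)"
    using c G by (subst nn_integral_cmult)
      (auto simp: mult.assoc[symmetric] ennreal_mult[symmetric] powr_diff)
  finally have "ennreal (Gamma a) = ennreal (Gamma a * c powr a) *
      (\<integral>\<^sup>+t. ennreal (indicator {0..} t * t powr (a - 1) / Gamma a * exp (- c * t)) \<partial>lborel)" .
  then have "ennreal (1 / (Gamma a * c powr a)) * ennreal (Gamma a) = 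
      ennreal (1 / (Gamma a * c powr a)) * ennreal (Gamma a * c powr a) *
      (\<integral>\<^sup>+t. ennreal (indicator {0..} t * t powr (a - 1) / Gamma a * exp (- c * t)) \<partial>lborel)"
    by (simp add: mult.assoc)
  then have *: "(\<integral>\<^sup>+t. ennreal (indicator {0..} t * t powr (a - 1) / Gamma a * exp (- c * t)) \<partial>lborel)
      = ennreal (c powr - a)"
    using G c by (simp add: ennreal_mult[symmetric] powr_minus field_simps)
  have "has_bochner_integral lborel (\<lambda>t. indicator {0..} t * t powr (a - 1) / Gamma a * exp (- c * t)) (c powr - a)"
    using G by (intro has_bochner_integral_nn_integral *) (auto split: split_indicator)
  then show ?thesis
    unfolding gamma_measure_def using G
    by (intro has_bochner_integral_density) (auto split: split_indicator)
qed

lemma emeasure_gamma_measure_atMost: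
  fixes a z :: real
  assumes a: "a > 0" and z: "z \<ge> 0"
  shows "emeasure (gamma_measure a) {..z} = ennreal (z powr a / Gamma (a + 1))"
proof -
  have G: "Gamma a > 0" using a by (rule Gamma_real_pos)
  have "((\<lambda>t. t powr (a - 1)) has_integral (z powr (a - 1 + 1) / (a - 1 + 1))) {0..z}"
    using a z by (intro has_integral_powr_from_0) auto
  then have "((\<lambda>t. t powr (a - 1) / Gamma a) has_integral z powr a / a / Gamma a) {0..z}"
    by (intro has_integral_divide) simp
  then have "(\<integral>\<^sup>+t. ennreal (indicator {0..z} t * (t powr (a - 1) / Gamma a)) \<partial>lborel)
      = ennreal (z powr a / a / Gamma a)"
    using G by (intro nn_integral_has_integral_lebesgue) auto
  moreover have "emeasure (gamma_measure a) {..z}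
      = (\<integral>\<^sup>+t. ennreal (indicator {0..z} t * (t powr (a - 1) / Gamma a)) \<partial>lborel)"
    unfolding gamma_measure_def
    by (subst emeasure_density) (auto intro!: nn_integral_cong split: split_indicator)
  moreover have "z powr a / a / Gamma a = z powr a / Gamma (a + 1)"
    using a Gamma_plus1[of a] by (simp add: mult.commute nonpos_Ints_def)
  ultimately show ?thesis by metis
qed

text \<open>\<open>exp (- u) * p (exp (- u))\<close> is a combination of the functions
  \<open>exp (- (i + 1) * u)\<close>, so the hypothesis is used at the points
  \<open>(i + 1) * s\<close>. Rescaling gives the limits \<open>(i + 1) powr - a * K\<close>, that
  is \<open>K\<close> times the transform of \<open>gamma_measure a\<close> at \<open>i + 1\<close>.
  The factor \<open>exp (- u)\<close> keeps out constants, which \<open>\<mu>\<close> need not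
  integrate.\<close>

lemma laplace_polynomial_limit:
  fixes \<mu> :: "real measure" and a K :: real and p :: "real \<Rightarrow> real"
  assumes a: "a > 0"
    and int: "\<And>s. s > 0 \<Longrightarrow> integrable \<mu> (\<lambda>y. exp (- s * y))"
    and lim: "((\<lambda>s. s powr a * (LINT y|\<mu>. exp (- s * y))) \<longlongrightarrow> K) (at_right 0)"
    and p: "real_polynomial_function p"
  shows "integrable (gamma_measure a) (\<lambda>t. exp (- t) * p (exp (- t)))"
    and "s > 0 \<Longrightarrow> integrable \<mu> (\<lambda>y. exp (- s * y) * p (exp (- s * y)))"
    and "((\<lambda>s. s powr a * (LINT y|\<mu>. exp (- s * y) * p (exp (- s * y)))) \<longlongrightarrow>
            K * (LINT t|gamma_measure a. exp (- t) * p (exp (- t)))) (at_right 0)"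
proof -
  obtain q n where p_eq: "p = (\<lambda>x. \<Sum>i\<le>n. q i * x ^ i)"
    using p by (auto simp: real_polynomial_function_iff_sum)
  have p_exp: "exp (- u) * p (exp (- u)) = (\<Sum>i\<le>n. q i * exp (- real (Suc i) * u))" for u :: real
    by (simp add: p_eq sum_distrib_left mult_ac exp_of_nat_mult[symmetric] exp_add[symmetric] algebra_simps)
  have p_exp': "exp (- s * y) * p (exp (- s * y)) = (\<Sum>i\<le>n. q i * exp (- (real (Suc i) * s) * y))" for s y :: real
    using p_exp[of "s * y"] by (simp only: mult.assoc mult_minus_left)
  have G: "has_bochner_integral (gamma_measure a) (\<lambda>t. exp (- real (Suc i) * t)) (real (Suc i) powr - a)" for i
    by (rule gamma_measure_exp) (use a in auto)
  have G': "has_bochner_integral (gamma_measure a) (\<lambda>t. exp (- t) * p (exp (- t)))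
      (\<Sum>i\<le>n. q i * real (Suc i) powr - a)"
    unfolding p_exp by (intro has_bochner_integral_sum has_bochner_integral_mult_right G)
  then show "integrable (gamma_measure a) (\<lambda>t. exp (- t) * p (exp (- t)))"
    by (simp add: has_bochner_integral_iff)
  have I: "integrable \<mu> (\<lambda>y. exp (- (real (Suc i) * s) * y))" if "s > 0" for s i
    by (rule int) (use that in auto)
  show "integrable \<mu> (\<lambda>y. exp (- s * y) * p (exp (- s * y)))" if "s > 0"
    unfolding p_exp' by (intro Bochner_Integration.integrable_sum integrable_mult_right I that)
  have lim1: "((\<lambda>s. s powr a * (LINT y|\<mu>. exp (- (real (Suc i) * s) * y))) \<longlongrightarrow> real (Suc i) powr - a * K) (at_right 0)" for i
  proof -
    have 1: "((\<lambda>s. (real (Suc i) * s) powr a * (LINT y|\<mu>. exp (- (real (Suc i) * s) * y))) \<longlongrightarrow> K) (at_right 0)"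
      by (rule filterlim_compose[OF lim])
        (auto simp: filterlim_at intro!: eventually_at_right_less tendsto_eq_intros 
              eventually_mono[OF eventually_at_right_less])
    have "((\<lambda>s. real (Suc i) powr - a * ((real (Suc i) * s) powr a * (LINT y|\<mu>. exp (- (real (Suc i) * s) * y)))) 
        \<longlongrightarrow> real (Suc i) powr - a * K) (at_right 0)"
      by (intro tendsto_mult_left 1)
    moreover have "real (Suc i) powr - a * ((real (Suc i) * s) powr a * z) = s powr a * z" if "s > 0" for s z
      using that by (simp add: powr_mult powr_minus field_simps del: of_nat_Suc)
    ultimately show ?thesis
      by (rule Lim_transform_eventually[OF _ eventually_mono[OF eventually_at_right_less]])
  qed
  have "((\<lambda>s. \<Sum>i\<le>n. q i * (s powr a * (LINT y|\<mu>. exp (- (real (Suc i) * s) * y)))) \<longlongrightarrow>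
      (\<Sum>i\<le>n. q i * (real (Suc i) powr - a * K))) (at_right 0)"
    by (intro tendsto_sum tendsto_mult_left lim1)
  moreover have "(\<Sum>i\<le>n. q i * (real (Suc i) powr - a * K)) = K * (LINT t|gamma_measure a. exp (- t) * p (exp (- t)))"
    using G' by (simp add: has_bochner_integral_iff sum_distrib_left mult_ac)
  moreover have "(\<Sum>i\<le>n. q i * (s powr a * (LINT y|\<mu>. exp (- (real (Suc i) * s) * y))))
      = s powr a * (LINT y|\<mu>. exp (- s * y) * p (exp (- s * y)))" if "s > 0" for s
    unfolding p_exp' using I[OF that]
    by (subst Bochner_Integration.integral_sum) (auto simp: sum_distrib_left mult_ac)
  ultimately show "((\<lambda>s. s powr a * (LINT y|\<mu>. exp (- s * y) * p (exp (- s * y)))) \<longlongrightarrow>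
            K * (LINT t|gamma_measure a. exp (- t) * p (exp (- t)))) (at_right 0)"
    by (metis (no_types, lifting) Lim_transform_eventually[OF _ eventually_mono[OF eventually_at_right_less]])
qed

text \<open>Weierstrass approximation: for \<open>y \<ge> 0\<close> the argument
  \<open>exp (- s * y)\<close> stays in \<open>[0, 1]\<close>, where \<open>h\<close> is uniformly
  close to a polynomial. The weight \<open>exp (- s * y)\<close> turns a uniform error
  \<open>d\<close> into \<open>d\<close> times the Laplace transform, which remains bounded after
  multiplication by \<open>s powr a\<close>.\<close>

lemma laplace_continuous_limit:
  fixes \<mu> :: "real measure" and a K :: real and h :: "real \<Rightarrow> real"
  assumes sets [measurable_cong]: "sets \<mu> = sets borel"
    and nonneg: "AE y in \<mu>. 0 \<le> y"
    and a: "a > 0"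
    and int: "\<And>s. s > 0 \<Longrightarrow> integrable \<mu> (\<lambda>y. exp (- s * y))"
    and lim: "((\<lambda>s. s powr a * (LINT y|\<mu>. exp (- s * y))) \<longlongrightarrow> K) (at_right 0)"
    and h: "continuous_on UNIV h"
  shows "integrable (gamma_measure a) (\<lambda>t. exp (- t) * h (exp (- t)))"
    and "s > 0 \<Longrightarrow> integrable \<mu> (\<lambda>y. exp (- s * y) * h (exp (- s * y)))"
    and "((\<lambda>s. s powr a * (LINT y|\<mu>. exp (- s * y) * h (exp (- s * y)))) \<longlongrightarrow>
            K * (LINT t|gamma_measure a. exp (- t) * h (exp (- t)))) (at_right 0)"
proof -
  have [measurable]: "h \<in> borel_measurable borel"
    using h by (rule borel_measurable_continuous_onI)
  have h01: "continuous_on {0..1} h" using h continuous_on_subset by blast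
  have "bounded (h ` {0..1})"
    by (intro compact_imp_bounded compact_continuous_image h01) auto
  then obtain D where D: "\<And>x. x \<in> {0..1} \<Longrightarrow> \<bar>h x\<bar> \<le> D"
    by (auto simp: bounded_iff) fastforce
  have gexp: "has_bochner_integral (gamma_measure a) (\<lambda>t. exp (- t)) 1"
    using gamma_measure_exp[OF a, of 1] by simp
  show Ig: "integrable (gamma_measure a) (\<lambda>t. exp (- t) * h (exp (- t)))"
  proof (rule Bochner_Integration.integrable_bound)
    show "integrable (gamma_measure a) (\<lambda>t. D * exp (- t))"
      using gexp by (simp add: has_bochner_integral_iff)
    show "AE t in gamma_measure a. norm (exp (- t) * h (exp (- t))) \<le> norm (D * exp (- t))"
      using AE_gamma_measure
    proof eventually_elim
      case (elim t)
      then show ?case using D[of "exp (- t)"] by (auto simp: abs_mult)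
    qed
  qed measurable
  have Im: "integrable \<mu> (\<lambda>y. exp (- s * y) * h (exp (- s * y)))" if "s > 0" for s
  proof (rule Bochner_Integration.integrable_bound)
    show "integrable \<mu> (\<lambda>y. D * exp (- s * y))"
      using int[OF that] by simp
    show "AE t in \<mu>. norm (exp (- s * t) * h (exp (- s * t))) \<le> norm (D * exp (- s * t))"
      using nonneg
    proof eventually_elim
      case (elim t)
      then show ?case using D[of "exp (- s * t)"] that by (auto simp: abs_mult)
    qed
  qed measurable
  then show "s > 0 \<Longrightarrow> integrable \<mu> (\<lambda>y. exp (- s * y) * h (exp (- s * y)))" .
  have K: "K \<ge> 0"
    by (rule tendsto_lowerbound[OF lim]) (auto intro!: always_eventually)
  show "((\<lambda>s. s powr a * (LINT y|\<mu>. exp (- s * y) * h (exp (- s * y)))) \<longlongrightarrow>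
            K * (LINT t|gamma_measure a. exp (- t) * h (exp (- t)))) (at_right 0)"
  proof (rule tendstoI)
    fix e :: real assume e: "e > 0"
    \<comment> \<open>Three errors have to fit into \<open>e\<close>: exchanging \<open>h\<close>
      and \<open>p\<close> under \<open>\<mu>\<close> costs \<open>d * (K + 1)\<close>, the limit
      for \<open>p\<close> costs \<open>d\<close>, and exchanging them under
      \<open>gamma_measure a\<close> costs \<open>d * K\<close>.\<close>
    define d where "d = e / (2 * (K + 1))"
    have d: "d > 0" using e K by (auto simp: d_def)
    have "d * (2 * (K + 1)) = e" using K by (simp add: d_def)
    then have de: "d * (K + 1) + d * K + d = e" by (simp add: algebra_simps)
    obtain p where p: "real_polynomial_function p" and hp: "\<And>x. x \<in> {0..1} \<Longrightarrow> \<bar>h x - p x\<bar> < d"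
      using Stone_Weierstrass_real_polynomial_function[OF _ h01 d] by auto
    note P = laplace_polynomial_limit[OF a int lim p]
    have ev1: "\<forall>\<^sub>F s in at_right 0. dist (s powr a * (LINT y|\<mu>. exp (- s * y) * p (exp (- s * y))))
        (K * (LINT t|gamma_measure a. exp (- t) * p (exp (- t)))) < d"
      using P(3) d by (rule tendstoD)
    have ev2: "\<forall>\<^sub>F s in at_right 0. s powr a * (LINT y|\<mu>. exp (- s * y)) < K + 1"
      using lim by (rule order_tendstoD) simp
    have bg: "\<bar>(LINT t|gamma_measure a. exp (- t) * h (exp (- t))) - (LINT t|gamma_measure a. exp (- t) * p (exp (- t)))\<bar> \<le> d"
    proof -
      have "\<bar>LINT t|gamma_measure a. exp (- t) * h (exp (- t)) - exp (- t) * p (exp (- t))\<bar>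
          \<le> (LINT t|gamma_measure a. d * exp (- t))"
      proof (rule integral_abs_bound[THEN order_trans], rule integral_mono_AE)
        show "AE t in gamma_measure a. \<bar>exp (- t) * h (exp (- t)) - exp (- t) * p (exp (- t))\<bar> \<le> d * exp (- t)"
          using AE_gamma_measure
        proof eventually_elim
          case (elim t)
          then have "\<bar>exp (- t) * (h (exp (- t)) - p (exp (- t)))\<bar> \<le> exp (- t) * d"
            using hp[of "exp (- t)"] by (auto simp: abs_mult)
          then show ?case by (simp add: algebra_simps)
        qed
      qed (use Ig P(1) gexp in \<open>auto simp: has_bochner_integral_iff\<close>)
      also have "\<dots> = d" using gexp by (simp add: has_bochner_integral_iff)
      finally show ?thesis using Ig P(1) by simp
    qed
    have bm: "\<bar>(LINT y|\<mu>. exp (- s * y) * h (exp (- s * y))) - (LINT y|\<mu>. exp (- s * y) * p (exp (- s * y)))\<bar>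
        \<le> d * (LINT y|\<mu>. exp (- s * y))" if s: "s > 0" for s
    proof -
      have Ip: "integrable \<mu> (\<lambda>y. exp (- s * y) * p (exp (- s * y)))"
        by (rule P(2)) (use s in auto)
      have "\<bar>LINT y|\<mu>. exp (- s * y) * h (exp (- s * y)) - exp (- s * y) * p (exp (- s * y))\<bar>
          \<le> (LINT y|\<mu>. d * exp (- s * y))"
      proof (rule integral_abs_bound[THEN order_trans], rule integral_mono_AE)
        show "AE t in \<mu>. \<bar>exp (- s * t) * h (exp (- s * t)) - exp (- s * t) * p (exp (- s * t))\<bar> \<le> d * exp (- s * t)"
          using nonneg
        proof eventually_elim
          case (elim t)
          then have "\<bar>exp (- s * t) * (h (exp (- s * t)) - p (exp (- s * t)))\<bar> \<le> exp (- s * t) * d"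
            using hp[of "exp (- s * t)"] s by (auto simp: abs_mult)
          then show ?case by (simp add: algebra_simps)
        qed
      qed (use Im[OF s] Ip int[OF s] in auto)
      then show ?thesis using Im[OF s] Ip by simp
    qed
    show "\<forall>\<^sub>F s in at_right 0. dist (s powr a * (LINT y|\<mu>. exp (- s * y) * h (exp (- s * y))))
        (K * (LINT t|gamma_measure a. exp (- t) * h (exp (- t)))) < e"
      using ev1 ev2 eventually_at_right_less[of 0]
    proof eventually_elim
      case (elim s)
      let ?L = "LINT y|\<mu>. exp (- s * y)"
      let ?H = "LINT y|\<mu>. exp (- s * y) * h (exp (- s * y))"
      let ?P = "LINT y|\<mu>. exp (- s * y) * p (exp (- s * y))"
      let ?Hg = "LINT t|gamma_measure a. exp (- t) * h (exp (- t))"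
      let ?Pg = "LINT t|gamma_measure a. exp (- t) * p (exp (- t))"
      have "\<bar>s powr a * ?H - s powr a * ?P\<bar> = s powr a * \<bar>?H - ?P\<bar>"
        by (simp add: abs_mult right_diff_distrib[symmetric])
      also have "\<dots> \<le> s powr a * (d * ?L)"
        by (intro mult_left_mono bm elim) auto
      also have "\<dots> = d * (s powr a * ?L)" by simp
      also have "\<dots> \<le> d * (K + 1)" using d elim(2) by (intro mult_left_mono) auto
      finally have 1: "\<bar>s powr a * ?H - s powr a * ?P\<bar> \<le> d * (K + 1)" .
      have "\<bar>K * ?Hg - K * ?Pg\<bar> = K * \<bar>?Hg - ?Pg\<bar>"
        using K by (simp add: abs_mult right_diff_distrib[symmetric])
      also have "\<dots> \<le> K * d" using K bg by (intro mult_left_mono) auto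
      finally have 2: "\<bar>K * ?Hg - K * ?Pg\<bar> \<le> d * K" by (simp add: mult.commute)
      show ?case
        using 1 2 elim(1) de unfolding dist_real_def by linarith
    qed
  qed
qed

text \<open>A continuous function squeezed between the indicators of \<open>{..1}\<close> and
  \<open>{..1 + d}\<close> brackets \<open>measure \<mu> {..x}\<close> after scaling. The gap closes
  as \<open>d\<close> tends to 0, since the mass of \<open>gamma_measure a\<close> on
  \<open>{..z}\<close> is continuous in \<open>z\<close>.\<close>

theorem karamata_tauberian:
  fixes \<mu> :: "real measure" and a K :: real
  assumes sets [measurable_cong]: "sets \<mu> = sets borel"
    and nonneg: "AE y in \<mu>. 0 \<le> y"
    and a: "a > 0"
    and int: "\<And>s. s > 0 \<Longrightarrow> integrable \<mu> (\<lambda>y. exp (- s * y))"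
    and lim: "((\<lambda>s. s powr a * (LINT y|\<mu>. exp (- s * y))) \<longlongrightarrow> K) (at_right 0)"
  shows "((\<lambda>x. measure \<mu> {..x} / x powr a) \<longlongrightarrow> K / Gamma (a + 1)) at_top"
proof -
  define \<Gamma> where "\<Gamma> = Gamma (a + 1)"
  have G: "\<Gamma> > 0" using a by (auto simp: \<Gamma>_def intro: Gamma_real_pos)
  have K: "K \<ge> 0"
    by (rule tendsto_lowerbound[OF lim]) (auto intro!: always_eventually)
  have fin: "emeasure \<mu> {..x} < \<infinity>" for x
  proof -
    have "emeasure \<mu> {..x} = (\<integral>\<^sup>+y. indicator {..x} y \<partial>\<mu>)" by simp
    also have "\<dots> \<le> (\<integral>\<^sup>+y. ennreal (exp x * exp (- 1 * y)) \<partial>\<mu>)"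
      by (intro nn_integral_mono) (auto simp: exp_minus field_simps split: split_indicator)
    also have "\<dots> < \<infinity>"
      using integrableD(2)[OF integrable_mult_right[OF int[of 1], of "exp x"]]
      by (simp add: less_top del: ennreal_mult'')
    finally show ?thesis .
  qed
  have intind: "integrable \<mu> (indicator {..x} :: real \<Rightarrow> real)" for x
    using fin[of x] by (simp add: integrable_indicator_iff)
  have bounds: "(\<forall>\<^sub>F x in at_top. measure \<mu> {..x} / x powr a < K * (1 + d) powr a / \<Gamma> + e) \<and>
      (\<forall>\<^sub>F x in at_top. (1 + d) powr - a * (K / \<Gamma> - e) < measure \<mu> {..x} / x powr a)" if d: "d > 0" and e: "e > 0" for d e
  proof -
    \<comment> \<open>\<open>h\<close> equals \<open>1 / x\<close> from \<open>exp (- 1)\<close> on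
      and tapers to 0 at \<open>c\<close>, so \<open>exp (- t) * h (exp (- t))\<close> is 1 for
      \<open>t \<le> 1\<close> and 0 for \<open>t \<ge> 1 + d\<close>. The denominator
      \<open>max x c\<close> keeps \<open>h\<close> continuous on the whole line.\<close>
    define c where "c = exp (- 1 - d)"
    define h where "h x = max 0 (min 1 ((x - c) / (exp (- 1) - c))) / max x c" for x
    have c: "0 < c" "c < exp (- 1)" using d by (auto simp: c_def)
    have hc: "continuous_on UNIV h"
      unfolding h_def using c by (intro continuous_intros) auto
    have h_lower: "indicator {..1} t \<le> exp (- t) * h (exp (- t))" for t
    proof (cases "t \<le> 1")
      case True
      then have "exp (- 1) \<le> exp (- t)" by simp
      with c have "(exp (- t) - c) / (exp (- 1) - c) \<ge> 1" by (simp add: field_simps)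
      then have "max 0 (min 1 ((exp (- t) - c) / (exp (- 1) - c))) = 1" by simp
      moreover have "max (exp (- t)) c = exp (- t)"
        using less_le_trans[OF c(2) \<open>exp (- 1) \<le> exp (- t)\<close>] by (intro max_absorb1 less_imp_le)
      ultimately show ?thesis using True by (simp only: h_def) simp
    qed (use c in \<open>auto simp: h_def\<close>)
    have h_upper: "exp (- t) * h (exp (- t)) \<le> indicator {..1 + d} t" for t
    proof (cases "t \<le> 1 + d")
      case True
      then have "exp (- t) \<ge> c" by (simp add: c_def)
      then have "max (exp (- t)) c = exp (- t)" by auto
      then show ?thesis using True by (simp add: h_def)
    next
      case False
      then have "exp (- t) < c" by (simp add: c_def)
      with c have "(exp (- t) - c) / (exp (- 1) - c) \<le> 0" by (auto simp: field_simps)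
      then show ?thesis by (simp add: h_def)
    qed
    note H = laplace_continuous_limit[OF sets nonneg a int lim hc]
    define J where "J = (LINT t|gamma_measure a. exp (- t) * h (exp (- t)))"
    define T where "T s = s powr a * (LINT y|\<mu>. exp (- s * y) * h (exp (- s * y)))" for s
    have T: "(T \<longlongrightarrow> K * J) (at_right 0)"
      using H(3) by (simp add: T_def[abs_def] J_def)
    have gm: "emeasure (gamma_measure a) {..z} = ennreal (z powr a / \<Gamma>)"
         "integrable (gamma_measure a) (indicator {..z} :: real \<Rightarrow> real)"
         "measure (gamma_measure a) {..z} = z powr a / \<Gamma>" if "z \<ge> 0" for z
      using emeasure_gamma_measure_atMost[OF a that] G
      by (auto simp: \<Gamma>_def[symmetric] measure_def integrable_indicator_iff)
    have "(LINT t|gamma_measure a. indicator {..1} t) \<le> J"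
      unfolding J_def by (intro integral_mono gm H h_lower) auto
    then have J1: "1 / \<Gamma> \<le> J" using gm[of 1] by simp
    have "J \<le> (LINT t|gamma_measure a. indicator {..1 + d} t)"
      unfolding J_def using d by (intro integral_mono gm H h_upper) auto
    then have J2: "J \<le> (1 + d) powr a / \<Gamma>" using gm[of "1 + d"] d by simp
    \<comment> \<open>The same quantity \<open>T\<close> serves for both bounds through two scales:
      \<open>s = 1 / x\<close> bounds \<open>measure \<mu> {..x}\<close> from above,
      \<open>s = (1 + d) / x\<close> from below.\<close>
    have Tl: "s powr a * measure \<mu> {..1 / s} \<le> T s" if "s > 0" for s
    proof -
      have "measure \<mu> {..1 / s} = (LINT y|\<mu>. indicator {..1 / s} y)" by simp
      also have "\<dots> \<le> (LINT y|\<mu>. exp (- s * y) * h (exp (- s * y)))"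
      proof (intro integral_mono intind H that)
        show "indicator {..1 / s} y \<le> exp (- s * y) * h (exp (- s * y))" for y
          using h_lower[of "s * y"] that by (auto simp: indicator_def field_simps)
      qed
      finally show ?thesis unfolding T_def by (intro mult_left_mono) auto
    qed
    have Tu: "T s \<le> s powr a * measure \<mu> {..(1 + d) / s}" if "s > 0" for s
    proof -
      have "(LINT y|\<mu>. exp (- s * y) * h (exp (- s * y))) \<le> (LINT y|\<mu>. indicator {..(1 + d) / s} y)"
      proof (intro integral_mono intind H that)
        show "exp (- s * y) * h (exp (- s * y)) \<le> indicator {..(1 + d) / s} y" for y
          using h_upper[of "s * y"] that by (auto simp: indicator_def field_simps)
      qed
      also have "\<dots> = measure \<mu> {..(1 + d) / s}" by simp
      finally show ?thesis unfolding T_def by (intro mult_left_mono) auto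
    qed
    have fl: "filterlim (\<lambda>x. k / x) (at_right 0) at_top" if "k > 0" for k :: real
      using that unfolding filterlim_at
      by (auto intro!: tendsto_divide_0[OF tendsto_const] filterlim_at_top_imp_at_infinity filterlim_ident
          eventually_mono[OF eventually_gt_at_top[of 0]])
    have "\<forall>\<^sub>F x in at_top. measure \<mu> {..x} / x powr a < K * (1 + d) powr a / \<Gamma> + e"
    proof -
      have "K * J \<le> K * ((1 + d) powr a / \<Gamma>)" using J2 K by (intro mult_left_mono) auto
      then have "K * J < K * (1 + d) powr a / \<Gamma> + e" using e by simp
      then have "\<forall>\<^sub>F s in at_right 0. T s < K * (1 + d) powr a / \<Gamma> + e"
        using T by (rule order_tendstoD(2)[rotated])
      then have "\<forall>\<^sub>F x in at_top. T (1 / x) < K * (1 + d) powr a / \<Gamma> + e"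
        using fl[of 1] by (auto simp: filterlim_iff)
      then show ?thesis using eventually_gt_at_top[of 0]
      proof eventually_elim
        case (elim x)
        then have "measure \<mu> {..x} / x powr a = (1 / x) powr a * measure \<mu> {..1 / (1 / x)}"
          by (simp add: powr_divide)
        also have "\<dots> \<le> T (1 / x)" using elim by (intro Tl) auto
        finally show ?case using elim by simp
      qed
    qed
    moreover have "\<forall>\<^sub>F x in at_top. (1 + d) powr - a * (K / \<Gamma> - e) < measure \<mu> {..x} / x powr a"
    proof -
      have "K * (1 / \<Gamma>) \<le> K * J" using J1 K by (intro mult_left_mono) auto
      then have "K / \<Gamma> - e < K * J" using e by simp
      then have "\<forall>\<^sub>F s in at_right 0. K / \<Gamma> - e < T s"
        using T by (rule order_tendstoD(1)[rotated])
      then have "\<forall>\<^sub>F x in at_top. K / \<Gamma> - e < T ((1 + d) / x)"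
        using fl[of "1 + d"] d by (auto simp: filterlim_iff)
      then show ?thesis using eventually_gt_at_top[of 0]
      proof eventually_elim
        case (elim x)
        have "K / \<Gamma> - e < ((1 + d) / x) powr a * measure \<mu> {..(1 + d) / ((1 + d) / x)}"
          using elim d by (intro less_le_trans[OF elim(1) Tu]) auto
        also have "\<dots> = (1 + d) powr a * (measure \<mu> {..x} / x powr a)"
          using elim d by (simp add: powr_divide)
        finally show ?case using d by (simp add: powr_minus field_simps)
      qed
    qed
    ultimately show ?thesis by blast
  qed
  show ?thesis
    unfolding \<Gamma>_def[symmetric]
  proof (rule order_tendstoI)
    fix u assume u: "K / \<Gamma> < u"
    have "((\<lambda>d. K * (1 + d) powr a / \<Gamma> + d) \<longlongrightarrow> K * (1 + 0) powr a / \<Gamma> + 0) (at_right 0)"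
      using G by (intro tendsto_intros) auto
    then have "\<forall>\<^sub>F d in at_right 0. K * (1 + d) powr a / \<Gamma> + d < u"
      by (rule order_tendstoD) (use u in auto)
    then have "\<forall>\<^sub>F d in at_right 0. K * (1 + d) powr a / \<Gamma> + d < u \<and> 0 < d"
      by (rule eventually_conj[OF _ eventually_at_right_less])
    then obtain d where d: "d > 0" "K * (1 + d) powr a / \<Gamma> + d < u"
      using eventually_happens'[OF trivial_limit_at_right_real] by blast
    show "\<forall>\<^sub>F x in at_top. measure \<mu> {..x} / x powr a < u"
      using bounds[OF d(1) d(1), THEN conjunct1] by eventually_elim (use d in auto)
  next
    fix u assume u: "u < K / \<Gamma>"
    have "((\<lambda>d::real. (1 + d) powr - a * (K / \<Gamma> - d)) \<longlongrightarrow> (1 + 0) powr - a * (K / \<Gamma> - 0)) (at_right 0)"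
      by (intro tendsto_intros) auto
    then have "\<forall>\<^sub>F d in at_right 0. u < (1 + d) powr - a * (K / \<Gamma> - d)"
      by (rule order_tendstoD) (use u in auto)
    then have "\<forall>\<^sub>F d in at_right 0. u < (1 + d) powr - a * (K / \<Gamma> - d) \<and> 0 < d"
      by (rule eventually_conj[OF _ eventually_at_right_less])
    then obtain d where d: "d > 0" "u < (1 + d) powr - a * (K / \<Gamma> - d)"
      using eventually_happens'[OF trivial_limit_at_right_real] by blast
    show "\<forall>\<^sub>F x in at_top. u < measure \<mu> {..x} / x powr a"
      using bounds[OF d(1) d(1), THEN conjunct2] by eventually_elim (use d in auto)
  qed
qed

section \<open>Exponential integrals\<close>

lemma dominated_convergence_at_within:
  fixes x :: "'b::first_countable_topology" and f :: "'b \<Rightarrow> 'a \<Rightarrow> real"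
  assumes "\<And>t. t \<in> S \<Longrightarrow> f t \<in> borel_measurable M" "g \<in> borel_measurable M" "integrable M w"
    and "\<And>t. t \<in> S \<Longrightarrow> AE y in M. norm (f t y) \<le> w y"
    and lim: "AE y in M. ((\<lambda>t. f t y) \<longlongrightarrow> g y) (at x within S)"
  shows "((\<lambda>t. LINT y|M. f t y) \<longlongrightarrow> (LINT y|M. g y)) (at x within S)"
  unfolding tendsto_at_iff_sequentially comp_def
proof (intro allI impI)
  fix X assume X: "\<forall>i. X i \<in> S - {x}" "X \<longlonglongrightarrow> x"
  show "(\<lambda>n. LINT y|M. f (X n) y) \<longlonglongrightarrow> (LINT y|M. g y)"
  proof (rule integral_dominated_convergence[where w = w])
    show "AE y in M. (\<lambda>n. f (X n) y) \<longlonglongrightarrow> g y"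
      using lim
    proof eventually_elim
      case (elim y)
      then show ?case using X unfolding tendsto_at_iff_sequentially comp_def by blast
    qed
  qed (use assms X in auto)
qed

text \<open>Integrability at two exponents thus supplies a majorant for all exponents in between,
  whatever the sign of \<open>y\<close>.\<close>

lemma exp_mult_le_add:
  fixes t u v y :: real
  assumes "u \<le> t" "t \<le> v"
  shows "exp (t * y) \<le> exp (u * y) + exp (v * y)"
proof (cases "y \<ge> 0")
  case True
  then have "exp (t * y) \<le> exp (v * y)" using assms by (simp add: mult_right_mono)
  then show ?thesis by (smt (verit) exp_gt_zero)
next
  case False
  then have "exp (t * y) \<le> exp (u * y)" using assms by (simp add: mult_right_mono_neg)
  then show ?thesis by (smt (verit) exp_gt_zero)
qed

lemma exp_diff_le:
  fixes x y :: real
  shows "\<bar>exp x - exp y\<bar> \<le> \<bar>x - y\<bar> * max (exp x) (exp y)"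
proof -
  have *: "exp v - exp u \<le> (v - u) * exp v" for u v :: real
  proof -
    have "exp v * (1 + (u - v)) \<le> exp v * exp (u - v)"
      by (intro mult_left_mono exp_ge_add_one_self) auto
    then show ?thesis by (simp add: exp_diff algebra_simps)
  qed
  show ?thesis
    using *[of x y] *[of y x] by (cases "x \<le> y") (auto simp: max_def)
qed

lemma isCont_exp_integral:
  fixes N :: "real measure" and w :: "real \<Rightarrow> real"
  assumes sets [measurable_cong]: "sets N = sets borel"
    and int: "\<And>t. p < t \<Longrightarrow> t < q \<Longrightarrow> integrable N (\<lambda>y. exp (t * y) * w y)"
    and t: "p < t" "t < q"
  shows "isCont (\<lambda>t. LINT y|N. exp (t * y) * w y) t"
proof -
  obtain u v where uv: "p < u" "u < t" "t < v" "v < q" using t dense by meson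
  have "((\<lambda>t. LINT y|N. exp (t * y) * w y) \<longlongrightarrow> (LINT y|N. exp (t * y) * w y)) (at t within {u<..<v})"
  proof (rule dominated_convergence_at_within)
    show "integrable N (\<lambda>y. exp (u * y) * \<bar>w y\<bar> + exp (v * y) * \<bar>w y\<bar>)"
      using integrable_abs[OF int[of u]] integrable_abs[OF int[of v]] uv by (simp add: abs_mult)
    show "AE y in N. norm (exp (s * y) * w y) \<le> exp (u * y) * \<bar>w y\<bar> + exp (v * y) * \<bar>w y\<bar>"
      if "s \<in> {u<..<v}" for s
      using that exp_mult_le_add[of u s v]
      by (auto simp: abs_mult distrib_right[symmetric] intro!: mult_right_mono)
    show "AE y in N. ((\<lambda>t. exp (t * y) * w y) \<longlongrightarrow> exp (t * y) * w y) (at t within {u<..<v})"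
      by (intro AE_I2 tendsto_intros)
    show "(\<lambda>y. exp (s * y) * w y) \<in> borel_measurable N" if "s \<in> {u<..<v}" for s
      using int[of s] that uv by auto
    show "(\<lambda>y. exp (t * y) * w y) \<in> borel_measurable N"
      using int[of t] t by auto
  qed
  then show ?thesis using uv by (simp add: isCont_def at_within_open[of t "{u<..<v}"])
qed

text \<open>Division by \<open>y\<close> cancels the factor \<open>y\<close> that differentiating
  \<open>exp (t * y)\<close> produces, so the difference quotients are dominated by
  \<open>exp (u * y) + exp (v * y)\<close> without any polynomial weight.\<close>

lemma has_real_derivative_exp_quotient_integral:
  fixes w :: "real \<Rightarrow> real"
  assumes int: "\<And>t. p < t \<Longrightarrow> t < q \<Longrightarrow> integrable lborel (\<lambda>y. exp (t * y) * w y)"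
    and int': "\<And>t. p < t \<Longrightarrow> t < q \<Longrightarrow> integrable lborel (\<lambda>y. (exp (t * y) - 1) / y * w y)"
    and t: "p < t" "t < q"
  shows "((\<lambda>t. LINT y|lborel. (exp (t * y) - 1) / y * w y) has_real_derivative
           (LINT y|lborel. exp (t * y) * w y)) (at t)"
proof -
  obtain u v where uv: "p < u" "u < t" "t < v" "v < q" using t dense by meson
  have q_eq: "((exp (s * y) - 1) / y * w y - (exp (t * y) - 1) / y * w y) / (s - t)
      = (exp (s * y) - exp (t * y)) / (s - t) / y * w y" for s y
    by (simp add: diff_divide_distrib algebra_simps)
  have lim: "((\<lambda>s. LINT y|lborel. (exp (s * y) - exp (t * y)) / (s - t) / y * w y) \<longlongrightarrow>
      (LINT y|lborel. exp (t * y) * w y)) (at t within {u<..<v})"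
  proof (rule dominated_convergence_at_within)
    show "integrable lborel (\<lambda>y. exp (u * y) * \<bar>w y\<bar> + exp (v * y) * \<bar>w y\<bar>)"
      using integrable_abs[OF int[of u]] integrable_abs[OF int[of v]] uv by (simp add: abs_mult)
    show "AE y in lborel. norm ((exp (s * y) - exp (t * y)) / (s - t) / y * w y)
        \<le> exp (u * y) * \<bar>w y\<bar> + exp (v * y) * \<bar>w y\<bar>" if s: "s \<in> {u<..<v}" for s
    proof (rule AE_I2)
      fix y :: real
      have "\<bar>(exp (s * y) - exp (t * y)) / (s - t) / y\<bar> \<le> exp (u * y) + exp (v * y)"
      proof (cases "s = t \<or> y = 0")
        case False
        have "\<bar>exp (s * y) - exp (t * y)\<bar> \<le> \<bar>s * y - t * y\<bar> * max (exp (s * y)) (exp (t * y))"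
          by (rule exp_diff_le)
        also have "\<dots> \<le> \<bar>s * y - t * y\<bar> * (exp (u * y) + exp (v * y))"
          using s uv exp_mult_le_add[of u s v y] exp_mult_le_add[of u t v y]
          by (intro mult_left_mono) auto
        also have "\<bar>s * y - t * y\<bar> = \<bar>s - t\<bar> * \<bar>y\<bar>" by (simp add: abs_mult[symmetric] algebra_simps)
        finally show ?thesis using False by (simp add: abs_mult divide_simps mult_ac)
      qed auto
      then show "norm ((exp (s * y) - exp (t * y)) / (s - t) / y * w y)
        \<le> exp (u * y) * \<bar>w y\<bar> + exp (v * y) * \<bar>w y\<bar>"
        unfolding real_norm_def abs_mult distrib_right[symmetric] by (rule mult_right_mono) auto
    qed
    show "AE y in lborel. ((\<lambda>s. (exp (s * y) - exp (t * y)) / (s - t) / y * w y) \<longlongrightarrow> exp (t * y) * w y)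
        (at t within {u<..<v})"
      \<comment> \<open>At \<open>y = 0\<close> the quotient is 0 by the convention for division and
        does not converge to the right value in general; the point is discarded as a null
        set.\<close>
      using AE_lborel_singleton[of 0]
    proof eventually_elim
      case (elim y)
      have "((\<lambda>s. exp (s * y)) has_real_derivative exp (t * y) * y) (at t within {u<..<v})"
        by (auto intro!: derivative_eq_intros)
      then have "((\<lambda>s. (exp (s * y) - exp (t * y)) / (s - t)) \<longlongrightarrow> exp (t * y) * y) (at t within {u<..<v})"
        by (simp add: has_field_derivative_iff)
      then have "((\<lambda>s. (exp (s * y) - exp (t * y)) / (s - t) / y * w y) \<longlongrightarrow> exp (t * y) * y / y * w y) (at t within {u<..<v})"
        using elim by (intro tendsto_intros) auto
      then show ?case using elim by simp
    qed
    show "(\<lambda>y. (exp (s * y) - exp (t * y)) / (s - t) / y * w y) \<in> borel_measurable lborel"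
      if "s \<in> {u<..<v}" for s
    proof -
      have "(\<lambda>y. ((exp (s * y) - 1) / y * w y - (exp (t * y) - 1) / y * w y) / (s - t)) \<in> borel_measurable lborel"
        using int'[of s] int'[of t] that uv
        by (intro borel_measurable_divide borel_measurable_diff borel_measurable_integrable) auto
      then show ?thesis by (simp only: q_eq)
    qed
    show "(\<lambda>y. exp (t * y) * w y) \<in> borel_measurable lborel"
      using int[of t] t by auto
  qed
  have eq: "(LINT y|lborel. (exp (s * y) - exp (t * y)) / (s - t) / y * w y)
      = ((LINT y|lborel. (exp (s * y) - 1) / y * w y) - (LINT y|lborel. (exp (t * y) - 1) / y * w y)) / (s - t)"
    if "s \<in> {u<..<v}" for s
    unfolding q_eq[symmetric] using int'[of s] int'[of t] that uv
    by (subst integral_divide_zero, subst Bochner_Integration.integral_diff) auto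
  have "((\<lambda>s. ((LINT y|lborel. (exp (s * y) - 1) / y * w y) - (LINT y|lborel. (exp (t * y) - 1) / y * w y)) / (s - t)) \<longlongrightarrow>
      (LINT y|lborel. exp (t * y) * w y)) (at t within {u<..<v})"
    by (rule Lim_transform_eventually[OF lim]) (unfold eventually_at_filter, intro always_eventually allI impI eq)
  then show ?thesis
    using uv by (simp add: has_field_derivative_iff at_within_open[of t "{u<..<v}"])
qed

lemma has_bochner_integral_exp_atLeast:
  fixes c :: real
  assumes c: "c > 0"
  shows "has_bochner_integral lborel (\<lambda>y. indicator {0..} y * exp (- c * y)) (1 / c)"
proof -
  have "((\<lambda>x. exp (- c * x)) has_integral exp (- c * 0) / c) {0..}"
    by (rule has_integral_exp_minus_to_infinity[OF c])
  then have "(\<integral>\<^sup>+y. ennreal (indicator {0..} y * exp (- c * y)) \<partial>lborel) = ennreal (1 / c)"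
    by (intro nn_integral_has_integral_lebesgue) auto
  then show ?thesis using c by (intro has_bochner_integral_nn_integral) auto
qed

lemma has_bochner_integral_exp_atMost:
  fixes c :: real
  assumes c: "c > 0"
  shows "has_bochner_integral lborel (\<lambda>y. indicator {..0} y * exp (c * y)) (1 / c)"
proof -
  have "has_bochner_integral lborel (\<lambda>y. indicator {0..} (0 + (-1) * y) * exp (- c * (0 + (-1) * y))) ((1 / c) /\<^sub>R \<bar>-1\<bar>)"
    using has_bochner_integral_exp_atLeast[OF c]
    by (subst (asm) lborel_has_bochner_integral_real_affine_iff[where c = "-1" and t = 0]) auto
  moreover have "indicator {0..} (0 + (-1) * y) * exp (- c * (0 + (-1) * y)) = indicator {..0} y * exp (c * y)" for y :: real
    by (auto split: split_indicator)
  ultimately show ?thesis by simp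
qed

lemma nn_integral_exp_lessThan:
  fixes c z :: real
  assumes c: "c > 0"
  shows "(\<integral>\<^sup>+y. ennreal (c * exp (c * y)) * indicator {..<z} y \<partial>lborel) = ennreal (exp (c * z))"
proof -
  have "has_bochner_integral lborel (\<lambda>y. indicator {..0} (- z + 1 * y) * exp (c * (- z + 1 * y))) ((1 / c) /\<^sub>R \<bar>1\<bar>)"
    using has_bochner_integral_exp_atMost[OF c]
    by (subst (asm) lborel_has_bochner_integral_real_affine_iff[where c = 1 and t = "- z"]) auto
  then have "has_bochner_integral lborel (\<lambda>y. (c * exp (c * z)) * (indicator {..0} (- z + 1 * y) * exp (c * (- z + 1 * y)))) (c * exp (c * z) * ((1 / c) /\<^sub>R \<bar>1\<bar>))"
    by (rule has_bochner_integral_mult_right)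
  then have "has_bochner_integral lborel (\<lambda>y. c * exp (c * y) * indicator {..z} y) (exp (c * z))"
    by (rule has_bochner_integral_cong[THEN iffD1, rotated -1])
      (use c in \<open>auto simp: exp_add[symmetric] algebra_simps split: split_indicator\<close>)
  then have "(\<integral>\<^sup>+y. ennreal (c * exp (c * y) * indicator {..z} y) \<partial>lborel) = ennreal (exp (c * z))"
    using c by (subst nn_integral_eq_integral) (auto simp: has_bochner_integral_iff)
  also have "(\<integral>\<^sup>+y. ennreal (c * exp (c * y) * indicator {..z} y) \<partial>lborel) =
      (\<integral>\<^sup>+y. ennreal (c * exp (c * y)) * indicator {..<z} y \<partial>lborel)"
    using AE_lborel_singleton[of z]
    by (intro nn_integral_cong_AE, elim eventually_mono) (auto split: split_indicator)
  finally show ?thesis .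
qed

text \<open>Tonelli applied to \<open>exp (c * z)\<close> written as the integral of
  \<open>c * exp (c * y)\<close> over \<open>y < z\<close>. Starting at minus infinity instead of 0
  avoids a boundary term and a separate formula for the negative half-line.\<close>

lemma (in real_distribution) nn_integral_exp_eq_tail:
  fixes c :: real
  assumes c: "c > 0"
  shows "(\<integral>\<^sup>+z. ennreal (exp (c * z)) \<partial>M) = (\<integral>\<^sup>+y. ennreal (c * exp (c * y) * measure M {y<..}) \<partial>lborel)"
proof -
  interpret P: pair_sigma_finite M lborel ..
  have "(\<integral>\<^sup>+z. ennreal (exp (c * z)) \<partial>M) = (\<integral>\<^sup>+z. (\<integral>\<^sup>+y. ennreal (c * exp (c * y)) * indicator {..<z} y \<partial>lborel) \<partial>M)"
    by (simp add: nn_integral_exp_lessThan[OF c])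
  also have "\<dots> = (\<integral>\<^sup>+z. (\<integral>\<^sup>+y. ennreal (c * exp (c * y)) * indicator {p. snd p < fst p} (z, y) \<partial>lborel) \<partial>M)"
    by (intro nn_integral_cong) (auto split: split_indicator)
  also have "\<dots> = (\<integral>\<^sup>+y. (\<integral>\<^sup>+z. ennreal (c * exp (c * y)) * indicator {p. snd p < fst p} (z, y) \<partial>M) \<partial>lborel)"
    by (rule P.Fubini'[symmetric]) measurable
  also have "\<dots> = (\<integral>\<^sup>+y. (\<integral>\<^sup>+z. ennreal (c * exp (c * y)) * indicator {y<..} z \<partial>M) \<partial>lborel)"
    by (intro nn_integral_cong) (auto split: split_indicator)
  also have "\<dots> = (\<integral>\<^sup>+y. ennreal (c * exp (c * y) * measure M {y<..}) \<partial>lborel)"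
    using c by (intro nn_integral_cong) (auto simp: nn_integral_cmult ennreal_mult emeasure_eq_measure)
  finally show ?thesis .
qed

section \<open>Distributions with an exponential tail\<close>

text \<open>As \<open>t\<close> grows, \<open>t * y\<close> moves monotonically away from 0 for
  either sign of \<open>y\<close>. The integrand at the critical exponent \<open>b\<close> therefore
  dominates those at all exponents in \<open>[0, b]\<close>, the endpoint included.\<close>

lemma exp_quotient_mono:
  fixes t u y :: real
  assumes "0 \<le> t" "t \<le> u"
  shows "\<bar>(exp (t * y) - 1) / y\<bar> \<le> \<bar>(exp (u * y) - 1) / y\<bar>"
proof (cases "y \<ge> 0")
  case True
  then have "t * y \<le> u * y" "0 \<le> t * y" using assms by (auto intro: mult_right_mono)
  then have "\<bar>exp (t * y) - 1\<bar> \<le> \<bar>exp (u * y) - 1\<bar>" by (simp add: abs_if)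
  then show ?thesis unfolding abs_divide by (rule divide_right_mono) auto
next
  case False
  then have "u * y \<le> t * y" "t * y \<le> 0" using assms by (auto intro: mult_right_mono_neg simp: mult_le_0_iff)
  then have "\<bar>exp (t * y) - 1\<bar> \<le> \<bar>exp (u * y) - 1\<bar>" by (simp add: abs_if)
  then show ?thesis unfolding abs_divide by (rule divide_right_mono) auto
qed

lemma (in real_distribution) tail_measurable [measurable]: "(\<lambda>y. measure M {y<..}) \<in> borel_measurable borel"
proof -
  have "(\<lambda>y. - measure M {y<..}) \<in> borel_measurable borel"
    by (intro borel_measurable_mono monoI) (auto intro!: finite_measure_mono)
  then show ?thesis using borel_measurable_uminus_eq by blast
qed

text \<open>In the notation of the theorem this is \<open>r y\<close> for \<open>y > 0\<close> and the negative of
  \<open>P(B \<le> y)\<close> for \<open>y < 0\<close>, so that both integrals in the constant \<open>K\<close> are parts of one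
  integral over the real line.\<close>

definition tail_defect :: "real measure \<Rightarrow> real \<Rightarrow> real \<Rightarrow> real \<Rightarrow> real" where
  "tail_defect M C b y = (if 0 < y then measure M {y<..} - C * exp (- b * y)
     else if y < 0 then measure M {y<..} - 1 else 0)"

text \<open>\<open>tail_limit\<close> bounds the defect and later drives the convolution estimate;
  \<open>defect_integrable\<close> expresses the finiteness of the two integrals in the constant at
  the critical exponent.\<close>

locale exponential_tail = real_distribution M for M :: "real measure" +
  fixes C b :: real
  assumes C_pos: "C > 0" and b_pos: "b > 0"
    and tail_limit: "((\<lambda>y. exp (b * y) * measure M {y<..}) \<longlongrightarrow> C) at_top"
    and defect_integrable: "integrable lborel (\<lambda>y. (exp (b * y) - 1) / y * tail_defect M C b y)"
begin

abbreviation "defect \<equiv> tail_defect M C b"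

definition "mgf t = (LINT z|M. exp (t * z))"

definition "defect_exponent t = (LINT y|lborel. (exp (t * y) - 1) / y * defect y)"

lemma defect_measurable [measurable]: "defect \<in> borel_measurable borel"
  unfolding tail_defect_def[abs_def] by measurable

lemma defect_neg: "y \<le> 0 \<Longrightarrow> defect y \<in> {-1..0}"
  by (auto simp: tail_defect_def)

lemma defect_bound:
  obtains D where "D > 0" "\<And>y. 0 < y \<Longrightarrow> \<bar>defect y\<bar> \<le> D * exp (- b * y)"
proof -
  have "\<forall>\<^sub>F y in at_top. \<bar>exp (b * y) * measure M {y<..} - C\<bar> < 1"
    using tendstoD[OF tail_limit, of 1] by (simp add: dist_real_def)
  then obtain Y where Y: "\<And>y. y \<ge> Y \<Longrightarrow> \<bar>exp (b * y) * measure M {y<..} - C\<bar> < 1"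
    by (auto simp: eventually_at_top_linorder)
  have eq: "\<bar>defect y\<bar> = exp (- b * y) * \<bar>exp (b * y) * measure M {y<..} - C\<bar>" if "y > 0" for y
  proof -
    have "defect y = exp (- b * y) * (exp (b * y) * measure M {y<..} - C)"
      using that by (simp add: tail_defect_def right_diff_distrib mult.assoc[symmetric] exp_add[symmetric])
    then show ?thesis by (simp add: abs_mult)
  qed
  show ?thesis
  proof
    \<comment> \<open>The constant merges two ranges: 1 covers \<open>y \<ge> Y\<close>, where the
      limit is nearly reached, and \<open>exp (b * Y) + C\<close> is the trivial bound for
      \<open>0 < y < Y\<close>.\<close>
    show "1 + exp (b * Y) + C > 0" using C_pos by (smt (verit) exp_gt_zero)
    fix y :: real assume y: "0 < y"
    have "\<bar>exp (b * y) * measure M {y<..} - C\<bar> \<le> 1 + exp (b * Y) + C"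
    proof (cases "y \<ge> Y")
      case True
      then show ?thesis using Y[of y] C_pos by (smt (verit) exp_gt_zero)
    next
      case False
      have "exp (b * y) * measure M {y<..} \<le> exp (b * Y) * 1"
        using False b_pos by (intro mult_mono) auto
      moreover have "0 \<le> exp (b * y) * measure M {y<..}" by simp
      ultimately show ?thesis using C_pos by linarith
    qed
    then show "\<bar>defect y\<bar> \<le> (1 + exp (b * Y) + C) * exp (- b * y)"
      unfolding eq[OF y] by (subst mult.commute) (rule mult_right_mono, auto)
  qed
qed

text \<open>On the right the defect is of order \<open>exp (- b * y)\<close>, which needs
  \<open>t < b\<close>; on the left it is merely bounded, which needs \<open>t > 0\<close>.\<close>

lemma integrable_exp_defect:
  assumes t: "0 < t" "t < b"
  shows "integrable lborel (\<lambda>y. exp (t * y) * defect y)"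
proof -
  obtain D where D: "D > 0" "\<And>y. 0 < y \<Longrightarrow> \<bar>defect y\<bar> \<le> D * exp (- b * y)"
    using defect_bound by blast
  show ?thesis
  proof (rule Bochner_Integration.integrable_bound)
    show "integrable lborel (\<lambda>y. D * (indicator {0..} y * exp (- (b - t) * y)) + indicator {..0} y * exp (t * y))"
      using has_bochner_integral_exp_atLeast[of "b - t"] has_bochner_integral_exp_atMost[of t] t
      by (intro Bochner_Integration.integrable_add integrable_mult_right) (auto simp: has_bochner_integral_iff)
    show "AE y in lborel. norm (exp (t * y) * defect y) \<le>
        norm (D * (indicator {0..} y * exp (- (b - t) * y)) + indicator {..0} y * exp (t * y))"
    proof (rule AE_I2)
      fix y :: real
      show "norm (exp (t * y) * defect y) \<le>
        norm (D * (indicator {0..} y * exp (- (b - t) * y)) + indicator {..0} y * exp (t * y))"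
      proof (cases "y > 0")
        case True
        have "exp (t * y) * \<bar>defect y\<bar> \<le> exp (t * y) * (D * exp (- b * y))"
          using D(2)[OF True] by simp
        also have "\<dots> = D * exp (- (b - t) * y)" by (simp add: exp_add[symmetric] algebra_simps)
        finally show ?thesis using True D(1) by (simp add: abs_mult)
      next
        case False
        have "exp (t * y) * \<bar>defect y\<bar> \<le> exp (t * y) * 1"
          using defect_neg[of y] False by (intro mult_left_mono) auto
        also have "\<dots> \<le> D * (indicator {0..} y * exp (- (b - t) * y)) + indicator {..0} y * exp (t * y)"
          using False D(1) by simp
        finally show ?thesis by (simp add: abs_mult)
      qed
    qed
  qed measurable
qed

lemma exp_quotient_defect_le:
  assumes "0 \<le> t" "t \<le> b"
  shows "norm ((exp (t * y) - 1) / y * defect y) \<le> norm ((exp (b * y) - 1) / y * defect y)"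
  unfolding real_norm_def abs_mult using exp_quotient_mono[OF assms] by (rule mult_right_mono) auto

lemma integrable_exp_quotient_defect:
  assumes "0 \<le> t" "t \<le> b"
  shows "integrable lborel (\<lambda>y. (exp (t * y) - 1) / y * defect y)"
  by (rule Bochner_Integration.integrable_bound[OF defect_integrable])
    (measurable, intro AE_I2 exp_quotient_defect_le[OF assms])

text \<open>Continuity up to both endpoints is the point: at 0 it gives the initial condition of the
  differential equation, at \<open>b\<close> the value entering the constant.\<close>

lemma defect_exponent_tendsto:
  assumes "x \<in> {0..b}"
  shows "(defect_exponent \<longlongrightarrow> defect_exponent x) (at x within {0..b})"
  unfolding defect_exponent_def
proof (rule dominated_convergence_at_within)
  show "integrable lborel (\<lambda>y. norm ((exp (b * y) - 1) / y * defect y))"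
    using defect_integrable by (rule integrable_norm)
  show "AE y in lborel. norm ((exp (t * y) - 1) / y * defect y) \<le> norm ((exp (b * y) - 1) / y * defect y)"
    if "t \<in> {0..b}" for t
    using that by (intro AE_I2 exp_quotient_defect_le) auto
  show "AE y in lborel. ((\<lambda>t. (exp (t * y) - 1) / y * defect y) \<longlongrightarrow> (exp (x * y) - 1) / y * defect y)
      (at x within {0..b})"
    using AE_lborel_singleton[of 0] by eventually_elim (auto intro!: tendsto_intros)
qed measurable

lemma defect_exponent_at_0: "(defect_exponent \<longlongrightarrow> 0) (at_right 0)"
  using defect_exponent_tendsto[of 0] b_pos
  by (simp add: at_within_Icc_at_right defect_exponent_def[of 0])

lemma defect_exponent_at_b: "(defect_exponent \<longlongrightarrow> defect_exponent b) (at_left b)"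
  using defect_exponent_tendsto[of b] b_pos by (simp add: at_within_Icc_at_left)

lemma DERIV_defect_exponent:
  assumes t: "0 < t" "t < b"
  shows "(defect_exponent has_real_derivative (LINT y|lborel. exp (t * y) * defect y)) (at t)"
  unfolding defect_exponent_def[abs_def]
  by (rule has_real_derivative_exp_quotient_integral[OF _ _ t])
    (intro integrable_exp_defect integrable_exp_quotient_defect; simp)+

text \<open>In the tail formula for \<open>exp (t * z)\<close> the tail is split into 1 on the left,
  \<open>C * exp (- b * y)\<close> on the right, and the defect. The three pieces integrate to 1, to
  the pole \<open>t * C / (b - t)\<close>, and to a remainder whose primitive in \<open>t\<close>,
  after division by \<open>t\<close>, is \<open>defect_exponent\<close>.\<close>

lemma has_bochner_integral_exp:
  assumes t: "0 < t" "t < b"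
  shows "has_bochner_integral M (\<lambda>z. exp (t * z))
           (1 + t * (C / (b - t) + (LINT y|lborel. exp (t * y) * defect y)))"
proof (rule has_bochner_integral_nn_integral)
  let ?I = "LINT y|lborel. exp (t * y) * defect y"
  have "has_bochner_integral lborel (\<lambda>y. t * (indicator {..0} y * exp (t * y)) +
      t * C * (indicator {0..} y * exp (- (b - t) * y)) + t * (exp (t * y) * defect y))
      (t * (1 / t) + t * C * (1 / (b - t)) + t * ?I)"
    using t integrable_exp_defect[OF t]
    by (intro has_bochner_integral_add has_bochner_integral_mult_right has_bochner_integral_exp_atMost
        has_bochner_integral_exp_atLeast) (auto simp: has_bochner_integral_iff)
  also have "?this \<longleftrightarrow> has_bochner_integral lborel (\<lambda>y. t * exp (t * y) * measure M {y<..})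
      (t * (1 / t) + t * C * (1 / (b - t)) + t * ?I)"
  proof (rule has_bochner_integral_cong_AE)
    show "AE y in lborel. t * (indicator {..0} y * exp (t * y)) +
      t * C * (indicator {0..} y * exp (- (b - t) * y)) + t * (exp (t * y) * defect y) =
      t * exp (t * y) * measure M {y<..}"
      \<comment> \<open>At 0 both indicators equal 1 and the decomposition counts twice; only this
        point is excluded.\<close>
      using AE_lborel_singleton[of 0]
    proof eventually_elim
      case (elim y)
      have "exp (- ((b - t) * y)) = exp (t * y) * exp (- (b * y))"
        by (simp add: exp_add[symmetric] algebra_simps)
      then show ?case using elim
        by (auto simp: tail_defect_def algebra_simps split: split_indicator)
    qed
  qed measurable
  also have "t * (1 / t) + t * C * (1 / (b - t)) + t * ?I = 1 + t * (C / (b - t) + ?I)"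
    using t by (simp add: algebra_simps)
  finally have *: "has_bochner_integral lborel (\<lambda>y. t * exp (t * y) * measure M {y<..}) (1 + t * (C / (b - t) + ?I))" .
  have "(\<integral>\<^sup>+z. ennreal (exp (t * z)) \<partial>M) = (\<integral>\<^sup>+y. ennreal (t * exp (t * y) * measure M {y<..}) \<partial>lborel)"
    using t by (intro nn_integral_exp_eq_tail)
  also have "\<dots> = ennreal (1 + t * (C / (b - t) + ?I))"
    using * t by (subst nn_integral_eq_integral) (auto simp: has_bochner_integral_iff)
  finally show "(\<integral>\<^sup>+z. ennreal (exp (t * z)) \<partial>M) = ennreal (1 + t * (C / (b - t) + ?I))" .
  have "0 \<le> (LINT y|lborel. t * exp (t * y) * measure M {y<..})"
    using t by (intro integral_nonneg_AE) auto
  then show "0 \<le> 1 + t * (C / (b - t) + ?I)"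
    using * by (simp add: has_bochner_integral_iff)
qed auto

lemma mgf_eq:
  assumes t: "0 < t" "t < b"
  shows "mgf t = 1 + t * (C / (b - t) + (LINT y|lborel. exp (t * y) * defect y))"
    and "integrable M (\<lambda>z. exp (t * z))"
    and "(\<integral>\<^sup>+z. ennreal (exp (t * z)) \<partial>M) = ennreal (mgf t)"
  using has_bochner_integral_exp[OF t]
  by (auto simp: has_bochner_integral_iff mgf_def nn_integral_eq_integral)

lemma mgf_isCont:
  assumes t: "0 < t" "t < b"
  shows "isCont mgf t"
  unfolding mgf_def[abs_def]
  using isCont_exp_integral[of M 0 b "\<lambda>_. 1" t] mgf_eq(2) t by auto

lemma mgf_linear_bound:
  assumes u: "0 < u" "u < b"
  obtains c where "c \<ge> 0" "\<And>t. 0 < t \<Longrightarrow> t \<le> u \<Longrightarrow> mgf t \<le> 1 + c * t"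
proof -
  obtain D where D: "D > 0" "\<And>y. 0 < y \<Longrightarrow> \<bar>defect y\<bar> \<le> D * exp (- b * y)"
    using defect_bound by blast
  show ?thesis
  proof
    show "C / (b - u) + D * (1 / (b - u)) \<ge> 0" using C_pos D(1) u by simp
    fix t assume t: "0 < t" "t \<le> u"
    have "(LINT y|lborel. exp (t * y) * defect y) \<le> (LINT y|lborel. D * (indicator {0..} y * exp (- (b - u) * y)))"
    proof (rule integral_mono)
      fix y :: real
      show "exp (t * y) * defect y \<le> D * (indicator {0..} y * exp (- (b - u) * y))"
      proof (cases "y > 0")
        case True
        have "exp (t * y) * defect y \<le> exp (u * y) * (D * exp (- b * y))"
          using D(1) D(2)[OF True] True t
          by (intro order_trans[OF mult_left_mono mult_right_mono]) auto
        also have "\<dots> = D * exp (- (b - u) * y)" by (simp add: exp_add[symmetric] algebra_simps)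
        finally show ?thesis using True by simp
      next
        case False
        then have "exp (t * y) * defect y \<le> 0" using defect_neg[of y] by (auto simp: mult_le_0_iff)
        also have "0 \<le> D * (indicator {0..} y * exp (- (b - u) * y))" using D(1) by simp
        finally show ?thesis .
      qed
    qed (use t u integrable_exp_defect[of t] has_bochner_integral_exp_atLeast[of "b - u"] in
        \<open>auto simp: has_bochner_integral_iff intro!: integrable_mult_right\<close>)
    also have "\<dots> = D * (1 / (b - u))"
      using has_bochner_integral_exp_atLeast[of "b - u"] u by (simp add: has_bochner_integral_iff)
    finally have 1: "(LINT y|lborel. exp (t * y) * defect y) \<le> D * (1 / (b - u))" .
    have 2: "C / (b - t) \<le> C / (b - u)"
      using t u C_pos by (intro divide_left_mono) auto
    have "mgf t = 1 + t * (C / (b - t) + (LINT y|lborel. exp (t * y) * defect y))"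
      using t u by (intro mgf_eq) auto
    also have "\<dots> \<le> 1 + t * (C / (b - u) + D * (1 / (b - u)))"
      using 1 2 t by (intro add_left_mono mult_left_mono add_mono) auto
    finally show "mgf t \<le> 1 + (C / (b - u) + D * (1 / (b - u))) * t" by (simp add: mult.commute)
  qed
qed

end

text \<open>The beta density is a power, so the substitution \<open>x = u * a\<close> turns the
  fixed-point equation into an integral equation for \<open>h u = u powr lam * \<phi> u\<close> with
  a variable upper limit. Differentiability of \<open>h\<close> follows from continuity of the
  integrand, and the resulting equation \<open>h' = (lam * mgf v / v) * h\<close> is integrated
  through its logarithm.\<close>

lemma (in exponential_tail) solution_of_beta_fixed_point:
  fixes N :: "real measure" and lam :: real
  defines "\<phi> \<equiv> \<lambda>t. LINT y|N. exp (t * y)"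
  assumes N: "real_distribution N" and lam: "lam > 0"
    and int: "\<And>t. 0 < t \<Longrightarrow> t < b \<Longrightarrow> integrable N (\<lambda>y. exp (t * y))"
    and eq: "\<And>u. 0 < u \<Longrightarrow> u < b \<Longrightarrow> (\<integral>\<^sup>+y. ennreal (exp (u * y)) \<partial>N) =
      (\<integral>\<^sup>+a. ennreal (indicator {0<..<1} a * lam * a powr (lam - 1)) *
        ((\<integral>\<^sup>+z. ennreal (exp (u * a * z)) \<partial>M) * (\<integral>\<^sup>+y. ennreal (exp (u * a * y)) \<partial>N)) \<partial>lborel)"
    and u: "0 < u" "u < b"
  shows "\<phi> u = (b / (b - u)) powr (lam * C) * exp (lam * defect_exponent u)"
proof -
  interpret N: real_distribution N by (rule N)
  define I where "I t = (LINT y|lborel. exp (t * y) * defect y)" for t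
  define g where "g v = lam * v powr (lam - 1) * mgf v * \<phi> v" for v
  define h where "h v = v powr lam * \<phi> v" for v
  have \<phi>_nn: "(\<integral>\<^sup>+y. ennreal (exp (t * y)) \<partial>N) = ennreal (\<phi> t)" if "0 < t" "t < b" for t
    unfolding \<phi>_def using int[OF that] by (intro nn_integral_eq_integral) auto
  have \<phi>_nonneg: "\<phi> t \<ge> 0" for t
    unfolding \<phi>_def by (rule integral_nonneg_AE) auto
  have \<phi>_pos: "\<phi> t > 0" if "0 < t" "t < b" for t
  proof -
    have "\<phi> t \<noteq> 0"
      unfolding \<phi>_def using int[OF that]
      by (subst integral_nonneg_eq_0_iff_AE) (auto simp: N.AE_False N.prob_space)
    then show ?thesis using \<phi>_nonneg[of t] by simp
  qed
  have mgf_nonneg: "mgf t \<ge> 0" for t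
    unfolding mgf_def by (rule integral_nonneg_AE) auto
  have \<phi>_cont: "isCont \<phi> t" if "0 < t" "t < b" for t
    unfolding \<phi>_def using isCont_exp_integral[of N 0 b "\<lambda>_. 1" t] int that by auto
  have [measurable]: "\<phi> \<in> borel_measurable borel" "mgf \<in> borel_measurable borel"
    unfolding \<phi>_def mgf_def[abs_def] by measurable
  have g_meas [measurable]: "g \<in> borel_measurable borel"
    unfolding g_def[abs_def] by measurable
  have g_nonneg: "g v \<ge> 0" for v
    unfolding g_def using lam mgf_nonneg \<phi>_nonneg by simp
  have g_cont: "isCont g v" if "0 < v" "v < b" for v
    unfolding g_def[abs_def] using that mgf_isCont \<phi>_cont by (intro continuous_intros) auto
  \<comment> \<open>The power \<open>v powr (lam - 1)\<close> released by the substitution, times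
    the Jacobian \<open>v\<close>, is exactly the weight \<open>v powr lam\<close> in
    \<open>h\<close>.\<close>
  have h_nn: "ennreal (h v) = (\<integral>\<^sup>+x. ennreal (g x) * indicator {0<..<v} x \<partial>lborel)" if v: "0 < v" "v < b" for v
  proof -
    have "(\<integral>\<^sup>+x. ennreal (g x) * indicator {0<..<v} x \<partial>lborel) =
        v * (\<integral>\<^sup>+x. ennreal (g (0 + v * x)) * indicator {0<..<v} (0 + v * x) \<partial>lborel)"
      using v by (subst nn_integral_real_affine[where c = v and t = 0]) (auto simp: abs_of_pos)
    also have "\<dots> = v * (\<integral>\<^sup>+a. ennreal (v powr (lam - 1)) * (ennreal (indicator {0<..<1} a * lam * a powr (lam - 1)) *
        ((\<integral>\<^sup>+z. ennreal (exp (v * a * z)) \<partial>M) * (\<integral>\<^sup>+y. ennreal (exp (v * a * y)) \<partial>N))) \<partial>lborel)"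
    proof (rule arg_cong2[where f = "(*)", OF refl], rule nn_integral_cong)
      fix a :: real
      show "ennreal (g (0 + v * a)) * indicator {0<..<v} (0 + v * a) = ennreal (v powr (lam - 1)) *
        (ennreal (indicator {0<..<1} a * lam * a powr (lam - 1)) *
        ((\<integral>\<^sup>+z. ennreal (exp (v * a * z)) \<partial>M) * (\<integral>\<^sup>+y. ennreal (exp (v * a * y)) \<partial>N)))"
      proof (cases "0 < a \<and> a < 1")
        case True
        then have va: "0 < v * a" "v * a < v" "v * a < b"
          using v by (auto intro: less_trans[of _ v])
        show ?thesis
          unfolding mgf_eq(3)[OF va(1,3)] \<phi>_nn[OF va(1,3)] g_def
          using True va lam v mgf_nonneg \<phi>_nonneg
          by (simp add: ennreal_mult[symmetric] powr_mult mult_ac)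
      next
        case False
        then show ?thesis using v by (auto simp: zero_less_mult_iff split: split_indicator)
      qed
    qed
    also have "\<dots> = v * (ennreal (v powr (lam - 1)) * (\<integral>\<^sup>+y. ennreal (exp (v * y)) \<partial>N))"
      by (subst nn_integral_cmult) (auto simp: eq[OF v])
    also have "\<dots> = ennreal (h v)"
      using v \<phi>_nonneg[of v] by (simp add: \<phi>_nn ennreal_mult[symmetric] h_def powr_diff)
    finally show ?thesis by simp
  qed
  have h_nonneg: "h v \<ge> 0" for v using \<phi>_nonneg by (simp add: h_def)
  \<comment> \<open>For \<open>lam < 1\<close> the integrand may blow up at 0, so the fundamental
    theorem of calculus is applied from a positive base point \<open>w\<close>.\<close>
  have h_diff: "h v = h w + integral {w..v} g" if wv: "0 < w" "w \<le> v" "v < b" for w v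
  proof -
    have cont: "continuous_on {w..v} g"
      using wv g_cont by (intro continuous_at_imp_continuous_on) auto
    have "((\<lambda>x. g x) has_integral integral {w..v} g) {w..v}"
      using cont by (intro integrable_integral integrable_continuous_real)
    then have i: "(\<integral>\<^sup>+x. ennreal (g x) * indicator {w..v} x \<partial>lborel) = ennreal (integral {w..v} g)"
      using g_nonneg by (intro nn_integral_has_integral_lebesgue')
    have "ennreal (h v) = (\<integral>\<^sup>+x. ennreal (g x) * indicator {0<..<v} x \<partial>lborel)"
      using wv by (intro h_nn) auto
    also have "\<dots> = (\<integral>\<^sup>+x. ennreal (g x) * indicator {0<..<w} x + ennreal (g x) * indicator {w..v} x \<partial>lborel)"
    proof (rule nn_integral_cong_AE)
      show "AE x in lborel. ennreal (g x) * indicator {0<..<v} x =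
          ennreal (g x) * indicator {0<..<w} x + ennreal (g x) * indicator {w..v} x"
        using AE_lborel_singleton[of v]
        by eventually_elim (use wv in \<open>auto split: split_indicator\<close>)
    qed
    also have "\<dots> = ennreal (h w) + ennreal (integral {w..v} g)"
      using wv by (subst nn_integral_add) (auto simp: i h_nn)
    also have "\<dots> = ennreal (h w + integral {w..v} g)"
      using h_nonneg g_nonneg cont by (intro ennreal_plus[symmetric] integral_nonneg integrable_continuous_real) auto
    finally show ?thesis
      using h_nonneg g_nonneg cont
      by (subst (asm) ennreal_inj) (auto intro!: add_nonneg_nonneg integral_nonneg integrable_continuous_real)
  qed
  have h_deriv: "(h has_real_derivative g v) (at v)" if v: "0 < v" "v < b" for v
  proof -
    obtain w x where wx: "0 < w" "w < v" "v < x" "x < b" using v dense by meson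
    have cont: "continuous_on {w..x} g"
      using wx g_cont by (intro continuous_at_imp_continuous_on) auto
    have "((\<lambda>s. integral {w..s} g) has_real_derivative g v) (at v within {w..x})"
      using cont wx by (intro integral_has_real_derivative) auto
    then have "((\<lambda>s. h w + integral {w..s} g) has_real_derivative g v) (at v within {w..x})"
      by (auto intro!: derivative_eq_intros)
    then have "((\<lambda>s. h w + integral {w..s} g) has_real_derivative g v) (at v)"
      using wx by (simp add: at_within_Icc_at)
    then show ?thesis
    proof (rule has_field_derivative_transform_within_open)
      show "h w + integral {w..s} g = h s" if "s \<in> {w<..<x}" for s
        using h_diff[of w s] that wx by auto
    qed (use wx in auto)
  qed
  \<comment> \<open>Up to an additive constant this is the logarithm of the ratio between
    \<open>h\<close> and the claimed solution multiplied by \<open>v powr lam\<close>; it is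
    constant because its derivative vanishes.\<close>
  define L where "L v = ln (h v) - lam * ln v + lam * C * ln (b - v) - lam * defect_exponent v" for v
  have L_deriv: "(L has_real_derivative 0) (at v)" if v: "0 < v" "v < b" for v
  proof -
    have hp: "h v > 0" using \<phi>_pos[OF v] v by (simp add: h_def)
    have "g v / h v = lam * mgf v / v"
      using v \<phi>_pos[OF v] by (simp add: g_def h_def powr_diff)
    also have "\<dots> = lam / v + lam * (C / (b - v) + I v)"
      using v unfolding mgf_eq(1)[OF v] I_def[symmetric] by (simp add: distrib_left add_divide_distrib)
    finally have *: "g v / h v = lam / v + lam * (C / (b - v) + I v)" .
    have "(L has_real_derivative (g v / h v - lam * (1 / v) + lam * C * (- 1 / (b - v)) - lam * I v)) (at v)"
      unfolding L_def[abs_def] I_def using hp v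
      by (auto intro!: derivative_eq_intros h_deriv DERIV_defect_exponent)
    then show ?thesis by (simp add: * algebra_simps)
  qed
  have "\<exists>c. \<forall>x\<in>{0<..<b}. L x = c"
  proof (rule has_field_derivative_zero_constant)
    show "convex {0<..<b}" by (rule convex_real_interval)
    fix x assume x: "x \<in> {0<..<b}"
    then have "(L has_real_derivative 0) (at x)" by (intro L_deriv) auto
    then show "(L has_real_derivative 0) (at x within {0<..<b})"
      by (rule has_field_derivative_at_within)
  qed
  then obtain c where c: "\<And>x. 0 < x \<Longrightarrow> x < b \<Longrightarrow> L x = c" by auto
  have L_alt: "L x = ln (\<phi> x) + lam * C * ln (b - x) - lam * defect_exponent x" if "0 < x" "x < b" for x
    using that \<phi>_pos[OF that] by (simp add: L_def h_def ln_mult ln_powr)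
  \<comment> \<open>This normalisation selects the one solution that is a transform of a probability
    law and thereby produces the factor \<open>b powr (lam * C)\<close>.\<close>
  have \<phi>_0: "(\<phi> \<longlongrightarrow> 1) (at_right 0)"
  proof -
    have "(\<phi> \<longlongrightarrow> (LINT y|N. 1)) (at 0 within {0..b / 2})"
      unfolding \<phi>_def
    proof (rule dominated_convergence_at_within)
      show "integrable N (\<lambda>y. 1 + exp (b / 2 * y))"
        using int[of "b / 2"] b_pos by simp
      show "AE y in N. norm (exp (t * y)) \<le> 1 + exp (b / 2 * y)" if "t \<in> {0..b / 2}" for t
        using that exp_mult_le_add[of 0 t "b / 2"] by auto
      show "AE y in N. ((\<lambda>t. exp (t * y)) \<longlongrightarrow> 1) (at 0 within {0..b / 2})"
        by (intro AE_I2 tendsto_eq_intros) auto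
    qed auto
    then show ?thesis using b_pos N.prob_space by (simp add: at_within_Icc_at_right)
  qed
  have "((\<lambda>x. ln (\<phi> x) + lam * C * ln (b - x) - lam * defect_exponent x) \<longlongrightarrow>
      ln 1 + lam * C * ln (b - 0) - lam * 0) (at_right 0)"
    using b_pos by (intro tendsto_intros \<phi>_0 defect_exponent_at_0) auto
  moreover have "\<forall>\<^sub>F x in at_right 0. ln (\<phi> x) + lam * C * ln (b - x) - lam * defect_exponent x = c"
    unfolding eventually_at_right_field using b_pos L_alt c by (intro exI[of _ b]) force
  ultimately have "((\<lambda>x. c) \<longlongrightarrow> lam * C * ln b) (at_right (0::real))"
    by (auto elim: Lim_transform_eventually)
  then have "c = lam * C * ln b"
    by (simp add: tendsto_const_iff)
  then have "ln (\<phi> u) = lam * C * (ln b - ln (b - u)) + lam * defect_exponent u"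
    using c[OF u] L_alt[OF u] by (simp add: algebra_simps)
  then have "\<phi> u = exp (lam * C * (ln b - ln (b - u)) + lam * defect_exponent u)"
    using \<phi>_pos[OF u] by (metis exp_ln)
  then show ?thesis
    using u b_pos by (simp add: exp_add powr_def ln_div)
qed

section \<open>Tail of a convolution at the critical exponent\<close>

lemma regularly_varying_shift:
  fixes G :: "real \<Rightarrow> real"
  assumes lim: "((\<lambda>x. G x / x powr a) \<longlongrightarrow> c) at_top"
  shows "((\<lambda>x. G (x + h) / x powr a) \<longlongrightarrow> c) at_top"
proof -
  have fl: "filterlim (\<lambda>x. x + h) at_top at_top"
    by (subst add.commute) (intro filterlim_tendsto_add_at_top[OF tendsto_const] filterlim_ident)
  have "((\<lambda>x. 1 + h / x) \<longlongrightarrow> 1 + 0) at_top"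
    by (intro tendsto_add tendsto_const real_tendsto_divide_at_top[OF tendsto_const] filterlim_ident)
  then have "((\<lambda>x. (1 + h / x) powr a) \<longlongrightarrow> (1 + 0) powr a) at_top"
    by (rule tendsto_powr[OF _ tendsto_const]) simp
  then have "((\<lambda>x. G (x + h) / (x + h) powr a * (1 + h / x) powr a) \<longlongrightarrow> c * (1 + 0) powr a) at_top"
    by (intro tendsto_mult filterlim_compose[OF lim fl])
  moreover have "\<forall>\<^sub>F x in at_top. G (x + h) / (x + h) powr a * (1 + h / x) powr a = G (x + h) / x powr a"
    using eventually_gt_at_top[of "max 0 (- h)"]
  proof eventually_elim
    case (elim x)
    then have "1 + h / x = (x + h) / x" by (simp add: field_simps)
    then show ?case using elim by (simp add: powr_divide)
  qed
  ultimately show ?thesis by (simp add: Lim_transform_eventually)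
qed

text \<open>\<open>N\<close> is arbitrary here: the beta structure enters only through the blow-up
  of its transform at \<open>b\<close>. Weighting \<open>N\<close> with \<open>exp (b * y)\<close>
  makes that transform at \<open>b - s\<close> the Laplace transform at \<open>s\<close>, as
  Karamata requires.\<close>

lemma (in exponential_tail) convolution_tail_asymptotics:
  fixes N :: "real measure" and a K :: real
  assumes N: "real_distribution N" and a: "a > 0"
    and int: "\<And>t. 0 < t \<Longrightarrow> t < b \<Longrightarrow> integrable N (\<lambda>y. exp (t * y))"
    and lim: "((\<lambda>s. s powr a * (LINT y|N. exp ((b - s) * y))) \<longlongrightarrow> K) (at_right 0)"
  shows "((\<lambda>x. exp (b * x) * (LINT y|N. measure M {x - y<..}) / x powr a) \<longlongrightarrow> C * (K / Gamma (a + 1))) at_top"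
proof -
  interpret N: real_distribution N by (rule N)
  define \<phi> where "\<phi> t = (LINT y|N. exp (t * y))" for t
  \<comment> \<open>The tilt is cut to \<open>y \<ge> 0\<close> so that the measure lives on the
    half-line; its total mass may be infinite, but half-lines \<open>{..x}\<close> have finite
    mass.\<close>
  define w where "w y = indicator {0..} y * exp (b * y)" for y :: real
  define U where "U = density N (\<lambda>y. ennreal (w y))"
  have [measurable]: "w \<in> borel_measurable borel" unfolding w_def[abs_def] by measurable
  have w_nonneg: "w y \<ge> 0" for y by (simp add: w_def)
  have setsU [measurable_cong]: "sets U = sets borel" by (simp add: U_def)
  have w_exp: "w y * exp (- s * y) = indicator {0..} y * exp ((b - s) * y)" for s y
    by (simp add: w_def exp_add[symmetric] algebra_simps)
  have bounded_int: "integrable N f" if "f \<in> borel_measurable borel" "\<And>y. \<bar>f y\<bar> \<le> c" for f :: "real \<Rightarrow> real" and c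
    by (rule N.integrable_const_bound[where B = c]) (use that in auto)
  have intw: "integrable N (\<lambda>y. w y * exp (- s * y))" if s: "s > 0" for s
  proof (cases "s < b")
    case True
    show ?thesis unfolding w_exp
      by (rule Bochner_Integration.integrable_bound[OF int[of "b - s"]])
        (use s True in \<open>auto split: split_indicator\<close>)
  next
    case False
    show ?thesis unfolding w_exp
      by (rule bounded_int[of _ 1]) (use False in \<open>auto split: split_indicator simp: mult_le_0_iff\<close>)
  qed
  define G where "G x = measure U {..x}" for x
  have G_lim: "((\<lambda>x. G x / x powr a) \<longlongrightarrow> K / Gamma (a + 1)) at_top"
    unfolding G_def
  proof (rule karamata_tauberian[OF setsU _ a])
    show "AE y in U. 0 \<le> y"
      unfolding U_def by (subst AE_density) (auto simp: w_def split: split_indicator)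
    show "integrable U (\<lambda>y. exp (- s * y))" if "s > 0" for s
      unfolding U_def using intw[OF that] w_nonneg by (subst integrable_density) auto
    have U_eq: "(LINT y|U. exp (- s * y)) = \<phi> (b - s) - (LINT y|N. indicator {..<0} y * exp ((b - s) * y))"
      if "0 < s" "s < b" for s
    proof -
      have "(LINT y|U. exp (- s * y)) = (LINT y|N. w y * exp (- s * y))"
        unfolding U_def using w_nonneg by (subst integral_density) auto
      also have "\<dots> = (LINT y|N. exp ((b - s) * y) - indicator {..<0} y * exp ((b - s) * y))"
        unfolding w_exp by (intro Bochner_Integration.integral_cong) (auto split: split_indicator)
      also have "\<dots> = \<phi> (b - s) - (LINT y|N. indicator {..<0} y * exp ((b - s) * y))"
        unfolding \<phi>_def using that
        by (intro Bochner_Integration.integral_diff int bounded_int[of _ 1])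
          (auto split: split_indicator simp: mult_le_0_iff)
      finally show ?thesis .
    qed
    \<comment> \<open>The negative half-line, cut off by \<open>w\<close>, contributes an integral
      in \<open>[0, 1]\<close>, which the factor \<open>s powr a\<close> eliminates.\<close>
    have "((\<lambda>s. s powr a * (LINT y|N. indicator {..<0} y * exp ((b - s) * y))) \<longlongrightarrow> 0) (at_right 0)"
    proof (rule tendsto_sandwich[OF _ _ tendsto_const])
      show "((\<lambda>s::real. s powr a) \<longlongrightarrow> 0) (at_right 0)"
        using a by (auto intro!: tendsto_eq_intros simp: eventually_at_filter)
      show "\<forall>\<^sub>F s in at_right 0. s powr a * (LINT y|N. indicator {..<0} y * exp ((b - s) * y)) \<le> s powr a"
        using eventually_at_right_real[OF b_pos]
      proof eventually_elim
        case (elim s)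
        have "(LINT y|N. indicator {..<0} y * exp ((b - s) * y)) \<le> (LINT y|N. 1)"
          by (intro integral_mono bounded_int[of _ 1])
            (use elim in \<open>auto split: split_indicator simp: mult_le_0_iff\<close>)
        then show ?case using N.prob_space by (simp add: mult_left_le)
      qed
      show "\<forall>\<^sub>F s in at_right 0. 0 \<le> s powr a * (LINT y|N. indicator {..<0} y * exp ((b - s) * y))"
        by (intro always_eventually allI mult_nonneg_nonneg integral_nonneg_AE) auto
    qed
    from tendsto_diff[OF lim[folded \<phi>_def] this]
    have "((\<lambda>s. s powr a * \<phi> (b - s) - s powr a * (LINT y|N. indicator {..<0} y * exp ((b - s) * y))) \<longlongrightarrow> K) (at_right 0)"
      by simp
    then show "((\<lambda>s. s powr a * (LINT y|U. exp (- s * y))) \<longlongrightarrow> K) (at_right 0)"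
    proof (rule Lim_transform_eventually)
      show "\<forall>\<^sub>F s in at_right 0. s powr a * \<phi> (b - s) - s powr a * (LINT y|N. indicator {..<0} y * exp ((b - s) * y)) =
          s powr a * (LINT y|U. exp (- s * y))"
        using eventually_at_right_real[OF b_pos]
        by eventually_elim (simp add: U_eq[simplified] right_diff_distrib)
    qed
  qed
  define \<kappa> where "\<kappa> = K / Gamma (a + 1)"
  have G_nonneg: "G x \<ge> 0" for x by (simp add: G_def)
  have \<kappa>: "\<kappa> \<ge> 0"
    unfolding \<kappa>_def by (rule tendsto_lowerbound[OF G_lim]) (auto intro!: always_eventually simp: G_nonneg)
  have G_shift: "((\<lambda>x. G (x + h) / x powr a) \<longlongrightarrow> \<kappa>) at_top" for h
    using regularly_varying_shift[OF G_lim] by (simp add: \<kappa>_def)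
  have intG: "integrable N (\<lambda>y. indicator {..x} y * w y)" for x
    by (rule bounded_int[of _ "exp (b * x)"])
      (use b_pos in \<open>auto simp: w_def split: split_indicator\<close>)
  have G_eq: "G x = (LINT y|N. indicator {..x} y * w y)" for x
  proof -
    have "emeasure U {..x} = (\<integral>\<^sup>+y. ennreal (indicator {..x} y * w y) \<partial>N)"
      unfolding U_def by (subst emeasure_density) (auto intro!: nn_integral_cong split: split_indicator)
    also have "\<dots> = ennreal (LINT y|N. indicator {..x} y * w y)"
      using w_nonneg by (intro nn_integral_eq_integral intG) auto
    finally show ?thesis unfolding G_def measure_def using w_nonneg by (simp add: integral_nonneg_AE)
  qed
  define T where "T u = measure M {u<..}" for u
  have [measurable]: "T \<in> borel_measurable borel" unfolding T_def[abs_def] by measurable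
  have T01: "0 \<le> T u" "T u \<le> 1" for u by (auto simp: T_def)
  have T_anti: "T u \<le> T v" if "v \<le> u" for u v
    unfolding T_def using that by (intro finite_measure_mono) auto
  have T_lim: "((\<lambda>u. exp (b * u) * T u) \<longlongrightarrow> C) at_top" using tail_limit by (simp add: T_def)
  have intT: "integrable N (\<lambda>y. T (x - y))" for x
    by (rule bounded_int[of _ 1]) (auto simp: abs_of_nonneg T01)
  have intI: "integrable N (\<lambda>y. indicator {x<..} y :: real)" for x
    by (rule bounded_int[of _ 1]) (auto simp: indicator_def)
  \<comment> \<open>The normalised contribution of \<open>y > x\<close>, where nothing better than
    \<open>T \<le> 1\<close> is available for the tail at the negative argument
    \<open>x - y\<close>.\<close>
  define Q where "Q x = exp (b * x) * measure N {x<..} / x powr a" for x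
  text \<open>The last term is the Chernoff bound for \<open>measure N {x + n<..}\<close> with exponent
    \<open>b - 1 / (x + n)\<close>, which the assumption on the Laplace transform controls.\<close>
  have Q_le: "\<forall>\<^sub>F x in at_top. Q x \<le> (G (x + n) / x powr a - G x / x powr a)
      + exp (1 - b * n) * ((x + n) powr - a * \<phi> (b - 1 / (x + n)) * (1 + n / x) powr a)" if n: "n \<ge> 0" for n
    using eventually_gt_at_top[of "max 0 (1 / b)"]
  proof eventually_elim
    case (elim x)
    then have x: "0 < x" "1 / b < x" by auto
    define s where "s = 1 / (x + n)"
    have "1 / b < x + n" using x n by simp
    then have s: "0 < s" "s < b" "s * (x + n) = 1" using x n b_pos by (auto simp: s_def field_simps)
    have "exp (b * x) * measure N {x<..} = (LINT y|N. exp (b * x) * indicator {x<..} y)"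
      by simp
    also have "\<dots> \<le> (LINT y|N. indicator {..x + n} y * w y - indicator {..x} y * w y + exp (1 - b * n) * exp ((b - s) * y))"
    proof (rule integral_mono)
      fix y :: real
      show "exp (b * x) * indicator {x<..} y \<le>
          indicator {..x + n} y * w y - indicator {..x} y * w y + exp (1 - b * n) * exp ((b - s) * y)"
      proof (cases "y \<le> x")
        case True
        then show ?thesis using n by simp
      next
        case False
        show ?thesis
        proof (cases "y \<le> x + n")
          case True
          have "exp (b * x) \<le> w y" using False x b_pos by (simp add: w_def)
          also have "\<dots> \<le> w y + exp (1 - b * n) * exp ((b - s) * y)" by simp
          finally show ?thesis using True False by simp
        next
          assume "\<not> y \<le> x + n"
          then have "(b - s) * (x + n) \<le> (b - s) * y" using s by (intro mult_left_mono) auto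
          then have "b * x \<le> 1 - b * n + (b - s) * y"
            using s(3) by (simp add: algebra_simps)
          then have "exp (b * x) \<le> exp (1 - b * n) * exp ((b - s) * y)" by (simp add: exp_add[symmetric])
          then show ?thesis using \<open>\<not> y \<le> x + n\<close> False by simp
        qed
      qed
      show "integrable N (\<lambda>y. exp (b * x) * indicator {x<..} y)"
        by (intro integrable_mult_right intI)
      show "integrable N (\<lambda>y. indicator {..x + n} y * w y - indicator {..x} y * w y + exp (1 - b * n) * exp ((b - s) * y))"
        using s by (intro Bochner_Integration.integrable_add Bochner_Integration.integrable_diff
            integrable_mult_right intG int) auto
    qed
    also have "\<dots> = G (x + n) - G x + exp (1 - b * n) * \<phi> (b - s)"
      using s intG int[of "b - s"] by (simp add: G_eq \<phi>_def)
    finally have "Q x \<le> (G (x + n) - G x + exp (1 - b * n) * \<phi> (b - s)) / x powr a"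
      unfolding Q_def by (intro divide_right_mono) auto
    also have "\<dots> = (G (x + n) / x powr a - G x / x powr a) + exp (1 - b * n) * \<phi> (b - s) * (1 / x powr a)"
      by (simp add: add_divide_distrib diff_divide_distrib)
    also have "1 / x powr a = (x + n) powr - a * (1 + n / x) powr a"
    proof -
      have "1 + n / x = (x + n) / x" using x by (simp add: field_simps)
      then show ?thesis using x n by (simp add: powr_divide powr_minus field_simps)
    qed
    also have "exp (1 - b * n) * \<phi> (b - s) * ((x + n) powr - a * (1 + n / x) powr a) =
        exp (1 - b * n) * ((x + n) powr - a * \<phi> (b - 1 / (x + n)) * (1 + n / x) powr a)"
      by (simp only: s_def mult_ac)
    finally show ?case .
  qed
  have Q_bound_lim: "((\<lambda>x. (G (x + n) / x powr a - G x / x powr a)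
      + exp (1 - b * n) * ((x + n) powr - a * \<phi> (b - 1 / (x + n)) * (1 + n / x) powr a)) \<longlongrightarrow>
        (\<kappa> - \<kappa>) + exp (1 - b * n) * (K * (1 + 0) powr a)) at_top" for n
  proof -
    have fl: "filterlim (\<lambda>x. x + n) at_top at_top"
      by (subst add.commute) (intro filterlim_tendsto_add_at_top[OF tendsto_const] filterlim_ident)
    have "filterlim (\<lambda>x. 1 / x :: real) (at_right 0) at_top"
      using filterlim_inverse_at_right_top by (simp add: inverse_eq_divide)
    then have "filterlim (\<lambda>x. 1 / (x + n)) (at_right 0) at_top"
      by (rule filterlim_compose[OF _ fl])
    from filterlim_compose[OF lim[folded \<phi>_def] this]
    have "((\<lambda>x. (1 / (x + n)) powr a * \<phi> (b - 1 / (x + n))) \<longlongrightarrow> K) at_top" .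
    then have 1: "((\<lambda>x. (x + n) powr - a * \<phi> (b - 1 / (x + n))) \<longlongrightarrow> K) at_top"
    proof (rule Lim_transform_eventually)
      show "\<forall>\<^sub>F x in at_top. (1 / (x + n)) powr a * \<phi> (b - 1 / (x + n)) = (x + n) powr - a * \<phi> (b - 1 / (x + n))"
        using eventually_gt_at_top[of "- n"] by eventually_elim (simp add: powr_divide powr_minus_divide)
    qed
    have 2: "((\<lambda>x. 1 + n / x) \<longlongrightarrow> 1 + 0) at_top"
      by (intro tendsto_add tendsto_const real_tendsto_divide_at_top[OF tendsto_const] filterlim_ident)
    show ?thesis
      using G_shift[of 0]
      by (intro tendsto_add tendsto_diff tendsto_mult tendsto_const tendsto_powr[OF 2] G_shift 1) auto
  qed
  \<comment> \<open>For fixed \<open>n\<close> the increment of \<open>G\<close> vanishes in the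
    limit and the bound tends to \<open>exp (1 - b * n) * K\<close>. Since \<open>n\<close> is free,
    it is chosen large enough to push this below \<open>e\<close>.\<close>
  have Q_lim: "(Q \<longlongrightarrow> 0) at_top"
  proof (rule order_tendstoI)
    fix e :: real assume e: "0 < e"
    have "((\<lambda>n. exp (1 - b * n) * K) \<longlongrightarrow> 0 * K) at_top"
    proof (intro tendsto_mult_right filterlim_compose[OF exp_at_bot])
      have "filterlim (\<lambda>n. - 1 + b * n) at_top at_top"
        using b_pos by (intro filterlim_tendsto_add_at_top[OF tendsto_const]
            filterlim_tendsto_pos_mult_at_top[OF tendsto_const] filterlim_ident)
      then show "filterlim (\<lambda>n. 1 - b * n) at_bot at_top"
        by (subst filterlim_uminus_at_bot) simp
    qed
    then have "\<forall>\<^sub>F n in at_top. exp (1 - b * n) * K < e"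
      using e by (intro order_tendstoD) auto
    then obtain n where n: "n \<ge> 0" "exp (1 - b * n) * K < e"
      using eventually_happens'[OF trivial_limit_at_top_linorder eventually_conj[OF _ eventually_ge_at_top[of 0]]] by blast
    have "\<forall>\<^sub>F x in at_top. (G (x + n) / x powr a - G x / x powr a)
      + exp (1 - b * n) * ((x + n) powr - a * \<phi> (b - 1 / (x + n)) * (1 + n / x) powr a) < e"
      using n by (intro order_tendstoD[OF Q_bound_lim]) simp
    then show "\<forall>\<^sub>F x in at_top. Q x < e"
      using Q_le[OF n(1)] by eventually_elim simp
  next
    fix e :: real assume "e < 0"
    then show "\<forall>\<^sub>F x in at_top. e < Q x"
      by (intro always_eventually allI) (auto simp: Q_def intro: less_le_trans)
  qed
  define S where "S x = (LINT y|N. T (x - y))" for x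
  have pinf: "((\<lambda>x::real. c / x powr a) \<longlongrightarrow> 0) at_top" for c
    using tendsto_mult_right_zero[OF tendsto_neg_powr[OF _ filterlim_ident], of "- a" c] a
    by (simp add: powr_minus divide_inverse)
  have "((\<lambda>x. exp (b * x) * S x / x powr a - C * (G x / x powr a)) \<longlongrightarrow> 0) at_top"
  proof (rule tendstoI)
    fix e :: real assume e: "e > 0"
    \<comment> \<open>Of the four error terms below only \<open>d * G x / x powr a\<close> survives
      in the limit, as \<open>d * \<kappa>\<close>; adding 1 guards against
      \<open>\<kappa> = 0\<close>.\<close>
    define d where "d = e / (2 * (\<kappa> + 1))"
    have d: "d > 0" "d * \<kappa> < e"
      using e \<kappa> by (auto simp: d_def field_simps) (smt (verit) mult_nonneg_nonneg)
    obtain m where m: "m \<ge> 0" "\<And>u. u \<ge> m \<Longrightarrow> \<bar>exp (b * u) * T u - C\<bar> < d"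
    proof -
      have "\<forall>\<^sub>F u in at_top. \<bar>exp (b * u) * T u - C\<bar> < d"
        using tendstoD[OF T_lim d(1)] by (simp add: dist_real_def)
      then obtain m where "\<And>u. u \<ge> m \<Longrightarrow> \<bar>exp (b * u) * T u - C\<bar> < d"
        by (auto simp: eventually_at_top_linorder)
      then show ?thesis by (intro that[of "max 0 m"]) auto
    qed
    \<comment> \<open>A crude bound on the window \<open>0 \<le> u < m\<close>, affordable because
      the window is weighted by \<open>G x - G (x - m)\<close>, which is negligible against
      \<open>x powr a\<close>.\<close>
    define D where "D = exp (b * m) + C"
    have D: "D \<ge> 0" "\<And>u. 0 \<le> u \<Longrightarrow> u < m \<Longrightarrow> \<bar>exp (b * u) * T u - C\<bar> \<le> D"
    proof -
      show "D \<ge> 0" using C_pos by (simp add: D_def)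
      fix u assume u: "0 \<le> u" "u < m"
      have "exp (b * u) * T u \<le> exp (b * m) * 1"
        using u b_pos T01 by (intro mult_mono) auto
      moreover have "0 \<le> exp (b * u) * T u" using T01 by simp
      ultimately show "\<bar>exp (b * u) * T u - C\<bar> \<le> D" using C_pos by (simp add: D_def abs_le_iff)
    qed
    have bound: "\<forall>\<^sub>F x in at_top. \<bar>exp (b * x) * S x / x powr a - C * (G x / x powr a)\<bar> \<le>
        (C + 1) / x powr a + d * (G x / x powr a) + D * (G x / x powr a - G (x + (- m)) / x powr a) + Q x"
      using eventually_ge_at_top[of m] order_tendstoD(2)[OF T_lim, of "C + 1", simplified]
    proof eventually_elim
      case (elim x)
      \<comment> \<open>One term for each position of \<open>y\<close>: for \<open>y < 0\<close> the
        tail at \<open>x\<close> itself gives \<open>C + 1\<close>; for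
        \<open>0 \<le> y \<le> x - m\<close> the relative error is \<open>d\<close>; in the window
        next to \<open>x\<close> it is \<open>D\<close>; beyond \<open>x\<close> the tail is bounded
        by 1.\<close>
      have pw: "\<bar>exp (b * x) * T (x - y) - C * (indicator {..x} y * w y)\<bar> \<le>
          (C + 1) + d * (indicator {..x} y * w y) + D * (indicator {..x} y * w y - indicator {..x - m} y * w y)
          + exp (b * x) * indicator {x<..} y" for y
      proof -
        have "exp (b * x) = exp (b * y) * exp (b * (x - y))"
          by (simp add: exp_add[symmetric] right_diff_distrib)
        then have tilt: "exp (b * x) * T (x - y) - C * exp (b * y) = exp (b * y) * (exp (b * (x - y)) * T (x - y) - C)"
          by (simp only: right_diff_distrib mult.assoc mult.commute[of C])
        consider "y < 0" | "0 \<le> y" "y \<le> x - m" | "0 \<le> y" "x - m < y" "y \<le> x" | "0 \<le> y" "x < y"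
          by linarith
        then show ?thesis
        proof cases
          case 1
          have "exp (b * x) * T (x - y) \<le> exp (b * x) * T x"
            using 1 by (intro mult_left_mono T_anti) auto
          also have "\<dots> \<le> C + 1" using elim by simp
          finally show ?thesis using 1 m elim T01 by (simp add: w_def)
        next
          case 2
          have "\<bar>exp (b * x) * T (x - y) - C * exp (b * y)\<bar> = exp (b * y) * \<bar>exp (b * (x - y)) * T (x - y) - C\<bar>"
            by (simp only: tilt abs_mult abs_exp_cancel)
          also have "\<dots> \<le> exp (b * y) * d"
            using m(2)[of "x - y"] 2 by (intro mult_left_mono) auto
          also have "\<dots> \<le> (C + 1) + d * exp (b * y)" using C_pos by simp
          finally show ?thesis using 2 m(1) by (simp add: w_def)
        next
          case 3
          have "\<bar>exp (b * x) * T (x - y) - C * exp (b * y)\<bar> = exp (b * y) * \<bar>exp (b * (x - y)) * T (x - y) - C\<bar>"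
            by (simp only: tilt abs_mult abs_exp_cancel)
          also have "\<dots> \<le> exp (b * y) * D"
            using D(2)[of "x - y"] 3 by (intro mult_left_mono) auto
          also have "\<dots> \<le> (C + 1) + d * exp (b * y) + D * exp (b * y)" using C_pos d by simp
          finally show ?thesis using 3 by (simp add: w_def)
        next
          case 4
          have "exp (b * x) * T (x - y) \<le> exp (b * x) * 1" by (intro mult_left_mono T01) auto
          then have "exp (b * x) * T (x - y) \<le> C + 1 + exp (b * x)" using C_pos by linarith
          then show ?thesis using 4 m(1) C_pos T01 by simp
        qed
      qed
      have "\<bar>exp (b * x) * S x - C * G x\<bar> = \<bar>LINT y|N. exp (b * x) * T (x - y) - C * (indicator {..x} y * w y)\<bar>"
        using intT intG by (simp add: S_def G_eq)
      also have "\<dots> \<le> (LINT y|N. (C + 1) + d * (indicator {..x} y * w y) + D * (indicator {..x} y * w y - indicator {..x - m} y * w y)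
          + exp (b * x) * indicator {x<..} y)"
      proof (rule integral_abs_bound[THEN order_trans], rule integral_mono)
        show "integrable N (\<lambda>y. (C + 1) + d * (indicator {..x} y * w y) + D * (indicator {..x} y * w y - indicator {..x - m} y * w y)
          + exp (b * x) * indicator {x<..} y)"
          by (intro Bochner_Integration.integrable_add integrable_mult_right Bochner_Integration.integrable_diff
              intG intI N.integrable_const)
      qed (use intT intG pw in auto)
      also have "\<dots> = (C + 1) + d * G x + D * (G x - G (x - m)) + exp (b * x) * measure N {x<..}"
        using intG intI N.prob_space by (simp add: G_eq)
      finally have "\<bar>exp (b * x) * S x - C * G x\<bar> / x powr a \<le>
          ((C + 1) + d * G x + D * (G x - G (x - m)) + exp (b * x) * measure N {x<..}) / x powr a"
        by (rule divide_right_mono) simp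
      moreover have "\<bar>exp (b * x) * S x - C * G x\<bar> / x powr a = \<bar>exp (b * x) * S x / x powr a - C * (G x / x powr a)\<bar>"
        by (simp add: abs_divide diff_divide_distrib[symmetric])
      ultimately show ?case
        by (simp add: Q_def add_divide_distrib diff_divide_distrib right_diff_distrib)
    qed
    have "((\<lambda>x. (C + 1) / x powr a + d * (G x / x powr a) + D * (G x / x powr a - G (x + (- m)) / x powr a) + Q x)
        \<longlongrightarrow> 0 + d * \<kappa> + D * (\<kappa> - \<kappa>) + 0) at_top"
      using G_shift[of 0] by (intro tendsto_intros G_shift pinf Q_lim) auto
    then have "\<forall>\<^sub>F x in at_top. (C + 1) / x powr a + d * (G x / x powr a) + D * (G x / x powr a - G (x + (- m)) / x powr a) + Q x < e"
      using d by (intro order_tendstoD) auto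
    then show "\<forall>\<^sub>F x in at_top. dist (exp (b * x) * S x / x powr a - C * (G x / x powr a)) 0 < e"
      using bound by eventually_elim (simp add: dist_real_def)
  qed
  from tendsto_add[OF this tendsto_mult_left[OF G_lim, of C]]
  show ?thesis by (simp add: S_def T_def)
qed

section \<open>Finiteness of the two integrals in the constant\<close>

lemma (in real_distribution) cdf_measurable [measurable]: "(\<lambda>y. measure M {..y}) \<in> borel_measurable borel"
  by (intro borel_measurable_mono monoI finite_measure_mono) auto

text \<open>By Tonelli the integral is the mean of \<open>ln (- z)\<close> over
  \<open>z \<le> -1\<close>, since \<open>1 / \<bar>y\<bar>\<close> integrates to
  \<open>ln (- z)\<close> on \<open>{z..-1}\<close>. This is where the logarithmic moment is
  consumed.\<close>

lemma (in real_distribution) integrable_left_tail_over_id: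
  assumes log: "integrable M (\<lambda>z. ln (1 + max 0 (- z)))"
  shows "integrable lborel (\<lambda>y. indicator {..-1} y * (measure M {..y} / \<bar>y\<bar>))"
proof (rule integrableI_nonneg)
  interpret P: pair_sigma_finite M lborel ..
  have inner: "(\<integral>\<^sup>+y. ennreal (1 / \<bar>y\<bar>) * indicator {z..-1} y \<partial>lborel) \<le> ennreal (ln (1 + max 0 (- z)))" for z :: real
  proof (cases "z \<le> -1")
    case True
    have "((\<lambda>y. 1 / \<bar>y\<bar>) has_integral (- ln (- (- 1)) - - ln (- z))) {z..-1}"
      using True
      by (intro fundamental_theorem_of_calculus)
        (auto intro!: derivative_eq_intros simp: has_real_derivative_iff_has_vector_derivative[symmetric] field_simps)
    then have "(\<integral>\<^sup>+y. ennreal (1 / \<bar>y\<bar>) * indicator {z..-1} y \<partial>lborel) = ennreal (ln (- z))"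
      by (subst nn_integral_has_integral_lebesgue') auto
    also have "\<dots> \<le> ennreal (ln (1 + max 0 (- z)))"
      using True by (intro ennreal_leI) auto
    finally show ?thesis .
  qed simp
  have "(\<integral>\<^sup>+y. ennreal (indicator {..-1} y * (measure M {..y} / \<bar>y\<bar>)) \<partial>lborel) =
      (\<integral>\<^sup>+y. \<integral>\<^sup>+z. ennreal (1 / \<bar>y\<bar>) * indicator {p. fst p \<le> snd p \<and> snd p \<le> -1} (z, y) \<partial>M \<partial>lborel)"
  proof (rule nn_integral_cong)
    fix y :: real
    have "(\<integral>\<^sup>+z. ennreal (1 / \<bar>y\<bar>) * indicator {p. fst p \<le> snd p \<and> snd p \<le> -1} (z, y) \<partial>M) =
        (\<integral>\<^sup>+z. ennreal (indicator {..-1} y / \<bar>y\<bar>) * indicator {..y} z \<partial>M)"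
      by (intro nn_integral_cong) (auto split: split_indicator)
    then show "ennreal (indicator {..-1} y * (measure M {..y} / \<bar>y\<bar>)) =
        (\<integral>\<^sup>+z. ennreal (1 / \<bar>y\<bar>) * indicator {p. fst p \<le> snd p \<and> snd p \<le> -1} (z, y) \<partial>M)"
      by (simp add: nn_integral_cmult emeasure_eq_measure ennreal_mult[symmetric])
  qed
  also have "\<dots> = (\<integral>\<^sup>+z. \<integral>\<^sup>+y. ennreal (1 / \<bar>y\<bar>) * indicator {p. fst p \<le> snd p \<and> snd p \<le> -1} (z, y) \<partial>lborel \<partial>M)"
    by (rule P.Fubini') measurable
  also have "\<dots> \<le> (\<integral>\<^sup>+z. ennreal (ln (1 + max 0 (- z))) \<partial>M)"
  proof (rule nn_integral_mono)
    fix z :: real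
    have "(\<integral>\<^sup>+y. ennreal (1 / \<bar>y\<bar>) * indicator {p. fst p \<le> snd p \<and> snd p \<le> -1} (z, y) \<partial>lborel) =
        (\<integral>\<^sup>+y. ennreal (1 / \<bar>y\<bar>) * indicator {z..-1} y \<partial>lborel)"
      by (intro nn_integral_cong) (auto split: split_indicator)
    then show "(\<integral>\<^sup>+y. ennreal (1 / \<bar>y\<bar>) * indicator {p. fst p \<le> snd p \<and> snd p \<le> -1} (z, y) \<partial>lborel)
        \<le> ennreal (ln (1 + max 0 (- z)))"
      using inner[of z] by simp
  qed
  also have "\<dots> < \<infinity>"
    using integrableD(2)[OF log] by (simp add: less_top)
  finally show "(\<integral>\<^sup>+y. ennreal (indicator {..-1} y * (measure M {..y} / \<bar>y\<bar>)) \<partial>lborel) < \<infinity>" .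
qed (auto intro!: AE_I2)

lemma exp_minus_one_le:
  fixes x :: real
  shows "0 \<le> x \<Longrightarrow> exp x - 1 \<le> x * exp x" "x \<le> 0 \<Longrightarrow> 1 - exp x \<le> - x"
proof -
  show "0 \<le> x \<Longrightarrow> exp x - 1 \<le> x * exp x"
    using exp_diff_le[of x 0] by (auto simp: max_def split: if_splits)
  show "x \<le> 0 \<Longrightarrow> 1 - exp x \<le> - x"
    using exp_ge_add_one_self[of x] by linarith
qed

text \<open>Near 0 the quotient is at most \<open>b\<close>; below -1 the numerator is at most 1 in
  absolute value, which leaves the distribution function over \<open>\<bar>y\<bar>\<close>.\<close>

lemma (in real_distribution) set_integrable_left_exponent:
  assumes b: "b > 0" and log: "integrable M (\<lambda>z. ln (1 + max 0 (- z)))"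
  shows "set_integrable lborel {..<0} (\<lambda>y. (exp (b * y) - 1) / y * measure M {..y})"
  unfolding set_integrable_def
proof (rule Bochner_Integration.integrable_bound)
  show "integrable lborel (\<lambda>y. b * indicator {-1..0} y + indicator {..-1} y * (measure M {..y} / \<bar>y\<bar>))"
    using integrable_left_tail_over_id[OF log] by (intro Bochner_Integration.integrable_add integrable_mult_right) auto
  show "AE y in lborel. norm (indicator {..<0} y *\<^sub>R ((exp (b * y) - 1) / y * measure M {..y})) \<le>
      norm (b * indicator {-1..0} y + indicator {..-1} y * (measure M {..y} / \<bar>y\<bar>))"
  proof (rule AE_I2)
    fix y :: real
    consider "y \<ge> 0" | "-1 \<le> y" "y < 0" | "y < -1" by linarith
    then show "norm (indicator {..<0} y *\<^sub>R ((exp (b * y) - 1) / y * measure M {..y})) \<le>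
      norm (b * indicator {-1..0} y + indicator {..-1} y * (measure M {..y} / \<bar>y\<bar>))"
    proof cases
      case 2
      have bneg: "b * y \<le> 0" using b 2 by (simp add: mult_le_0_iff)
      then have "\<bar>exp (b * y) - 1\<bar> = 1 - exp (b * y)" by simp
      also have "\<dots> \<le> b * \<bar>y\<bar>" using exp_minus_one_le(2)[OF bneg] 2 by simp
      finally have "\<bar>(exp (b * y) - 1) / y\<bar> \<le> b" using 2 by (simp add: divide_simps)
      then have "\<bar>(exp (b * y) - 1) / y\<bar> * measure M {..y} \<le> b * 1"
        using b by (intro mult_mono) auto
      also have "\<dots> \<le> b * indicator {-1..0} y + indicator {..-1} y * (measure M {..y} / \<bar>y\<bar>)"
        using 2 by (cases "y = -1") auto
      finally show ?thesis using 2 by (simp add: abs_mult)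
    next
      case 3
      have bneg: "b * y \<le> 0" using b 3 by (simp add: mult_le_0_iff)
      then have "\<bar>exp (b * y) - 1\<bar> \<le> 1" by (simp add: abs_if)
      then have "\<bar>exp (b * y) - 1\<bar> / \<bar>y\<bar> * measure M {..y} \<le> 1 / \<bar>y\<bar> * measure M {..y}"
        by (intro mult_right_mono divide_right_mono) auto
      then show ?thesis using 3 by (simp add: abs_mult)
    qed simp
  qed
qed measurable

text \<open>Below 1 the quotient and \<open>r\<close> are bounded; above 1 the two parts of
  \<open>r\<close> are controlled by their own hypotheses, the exponent \<open>b + eps\<close>
  dominating \<open>b\<close>. Since \<open>r\<close> is a given function only on the half-line in
  effect, the Borel function \<open>R\<close> carries the measurability.\<close>

lemma set_integrable_right_exponent:
  fixes r R :: "real \<Rightarrow> real"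
  assumes b: "b > 0" and eps: "eps > 0" and [measurable]: "R \<in> borel_measurable borel"
    and r_eq: "\<And>y. 0 < y \<Longrightarrow> r y = R y" and bounded: "\<And>y. 0 < y \<Longrightarrow> \<bar>r y\<bar> \<le> c"
    and r_plus: "set_integrable lborel {1..} (\<lambda>y. exp (b * y) / y * max 0 (r y))"
    and r_minus: "set_integrable lborel {1..} (\<lambda>y. exp ((b + eps) * y) / y * max 0 (- r y))"
  shows "set_integrable lborel {0<..} (\<lambda>y. (exp (b * y) - 1) / y * r y)"
  unfolding set_integrable_def
proof (rule Bochner_Integration.integrable_bound)
  let ?P = "\<lambda>y. indicator {1..} y *\<^sub>R (exp (b * y) / y * max 0 (r y))"
  let ?M = "\<lambda>y. indicator {1..} y *\<^sub>R (exp ((b + eps) * y) / y * max 0 (- r y))"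
  show "integrable lborel (\<lambda>y. b * exp b * c * indicator {0..1} y + ?P y + ?M y)"
    using r_plus r_minus unfolding set_integrable_def
    by (intro Bochner_Integration.integrable_add integrable_mult_right) auto
  show "AE y in lborel. norm (indicator {0<..} y *\<^sub>R ((exp (b * y) - 1) / y * r y)) \<le>
      norm (b * exp b * c * indicator {0..1} y + ?P y + ?M y)"
  proof (rule AE_I2)
    fix y :: real
    have c: "c \<ge> 0" using bounded[of 1] by simp
    consider "y \<le> 0" | "0 < y" "y < 1" | "1 \<le> y" by linarith
    then show "norm (indicator {0<..} y *\<^sub>R ((exp (b * y) - 1) / y * r y)) \<le>
      norm (b * exp b * c * indicator {0..1} y + ?P y + ?M y)"
    proof cases
      case 2
      have "exp (b * y) - 1 \<le> b * y * exp (b * y)" using b 2 by (intro exp_minus_one_le) auto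
      also have "\<dots> \<le> b * y * exp b" using b 2 by (intro mult_left_mono) auto
      finally have "(exp (b * y) - 1) / y \<le> b * exp b" using 2 by (simp add: field_simps)
      then have "(exp (b * y) - 1) / y * \<bar>r y\<bar> \<le> b * exp b * c"
        using bounded[of y] b c 2 by (intro mult_mono) auto
      then show ?thesis using 2 b c by (simp add: abs_mult)
    next
      case 3
      have ry: "\<bar>r y\<bar> = max 0 (r y) + max 0 (- r y)" by auto
      have "(exp (b * y) - 1) / y * \<bar>r y\<bar> \<le> exp (b * y) / y * \<bar>r y\<bar>"
        using 3 by (intro mult_right_mono divide_right_mono) auto
      also have "\<dots> = exp (b * y) / y * max 0 (r y) + exp (b * y) / y * max 0 (- r y)"
        unfolding ry by (rule distrib_left)
      also have "\<dots> \<le> ?P y + ?M y"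
        using 3 eps b by (auto intro!: add_mono mult_right_mono divide_right_mono)
      also have "\<dots> \<le> \<bar>b * exp b * c * indicator {0..1} y + ?P y + ?M y\<bar>"
      proof -
        have "0 \<le> b * exp b * c * indicator {0..1} y" using b c by simp
        then show ?thesis by linarith
      qed
      finally show ?thesis using 3 b by (simp add: abs_mult)
    qed simp
  qed
  have "(\<lambda>y. indicator {0<..} y *\<^sub>R ((exp (b * y) - 1) / y * r y)) = (\<lambda>y. indicator {0<..} y *\<^sub>R ((exp (b * y) - 1) / y * R y))"
    by (auto simp: fun_eq_iff r_eq split: split_indicator)
  then show "(\<lambda>y. indicator {0<..} y *\<^sub>R ((exp (b * y) - 1) / y * r y)) \<in> borel_measurable lborel"
    by simp
qed

section \<open>Perpetuities with beta-distributed factors\<close>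

text \<open>Only the outer variable is replaced by its law. The inner one stays a random variable,
  so that identities for integrals over \<open>M\<close> apply to it directly.\<close>

lemma (in prob_space) indep_var_nn_integral:
  assumes "indep_var S X T Y" and f [measurable]: "f \<in> borel_measurable (S \<Otimes>\<^sub>M T)"
  shows "(\<integral>\<^sup>+\<omega>. f (X \<omega>, Y \<omega>) \<partial>M) = (\<integral>\<^sup>+x. \<integral>\<^sup>+\<omega>. f (x, Y \<omega>) \<partial>M \<partial>distr M S X)"
    and "(\<integral>\<^sup>+\<omega>. f (X \<omega>, Y \<omega>) \<partial>M) = (\<integral>\<^sup>+y. \<integral>\<^sup>+\<omega>. f (X \<omega>, y) \<partial>M \<partial>distr M T Y)"
proof -
  have [measurable]: "random_variable S X" "random_variable T Y"
    and eq: "distr M S X \<Otimes>\<^sub>M distr M T Y = distr M (S \<Otimes>\<^sub>M T) (\<lambda>x. (X x, Y x))"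
    using assms(1) unfolding indep_var_distribution_eq by auto
  interpret X: prob_space "distr M S X" by (rule prob_space_distr) measurable
  interpret Y: prob_space "distr M T Y" by (rule prob_space_distr) measurable
  interpret XY: pair_sigma_finite "distr M S X" "distr M T Y" ..
  have joint: "(\<integral>\<^sup>+\<omega>. f (X \<omega>, Y \<omega>) \<partial>M) = (\<integral>\<^sup>+p. f p \<partial>(distr M S X \<Otimes>\<^sub>M distr M T Y))"
    unfolding eq by (simp add: nn_integral_distr)
  also have "\<dots> = (\<integral>\<^sup>+x. \<integral>\<^sup>+y. f (x, y) \<partial>distr M T Y \<partial>distr M S X)"
    by (rule Y.nn_integral_fst[symmetric]) measurable
  also have "\<dots> = (\<integral>\<^sup>+x. \<integral>\<^sup>+\<omega>. f (x, Y \<omega>) \<partial>M \<partial>distr M S X)"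
    by (intro nn_integral_cong nn_integral_distr) auto
  finally show "(\<integral>\<^sup>+\<omega>. f (X \<omega>, Y \<omega>) \<partial>M) = (\<integral>\<^sup>+x. \<integral>\<^sup>+\<omega>. f (x, Y \<omega>) \<partial>M \<partial>distr M S X)" .
  note joint
  also have "(\<integral>\<^sup>+p. f p \<partial>(distr M S X \<Otimes>\<^sub>M distr M T Y)) = (\<integral>\<^sup>+y. \<integral>\<^sup>+x. f (x, y) \<partial>distr M S X \<partial>distr M T Y)"
    by (rule XY.nn_integral_snd[symmetric]) measurable
  also have "\<dots> = (\<integral>\<^sup>+y. \<integral>\<^sup>+\<omega>. f (X \<omega>, y) \<partial>M \<partial>distr M T Y)"
    by (intro nn_integral_cong nn_integral_distr) auto
  finally show "(\<integral>\<^sup>+\<omega>. f (X \<omega>, Y \<omega>) \<partial>M) = (\<integral>\<^sup>+y. \<integral>\<^sup>+\<omega>. f (X \<omega>, y) \<partial>M \<partial>distr M T Y)" .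
qed

text \<open>At most \<open>1 + Z \<omega> / d\<close> of the indices \<open>k\<close> satisfy
  \<open>k * d < Z \<omega>\<close>; taking means bounds the partial sums. It feeds
  Borel-Cantelli.\<close>

lemma (in prob_space) summable_prob_multiples:
  fixes Z :: "'a \<Rightarrow> real"
  assumes Z: "integrable M Z" and nonneg: "\<And>\<omega>. \<omega> \<in> space M \<Longrightarrow> 0 \<le> Z \<omega>" and d: "d > 0"
  shows "summable (\<lambda>k::nat. prob {\<omega> \<in> space M. real k * d < Z \<omega>})"
proof (rule summableI_nonneg_bounded)
  have [measurable]: "Z \<in> borel_measurable M" using Z by simp
  fix n
  have count: "(\<Sum>k<n. indicator {\<omega> \<in> space M. real k * d < Z \<omega>} \<omega> :: real) \<le> 1 + Z \<omega> / d"
    if \<omega>: "\<omega> \<in> space M" for \<omega>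
  proof -
    have "(\<Sum>k<n. indicator {\<omega> \<in> space M. real k * d < Z \<omega>} \<omega> :: real) = real (card {k. k < n \<and> real k * d < Z \<omega>})"
      using \<omega> by (simp add: indicator_def sum.If_cases Int_def lessThan_def)
    also have "\<dots> \<le> real (card {..<nat \<lceil>Z \<omega> / d\<rceil>})"
    proof (intro of_nat_mono card_mono subsetI)
      fix k assume "k \<in> {k. k < n \<and> real k * d < Z \<omega>}"
      then have "real k < Z \<omega> / d" using d by (simp add: field_simps)
      then show "k \<in> {..<nat \<lceil>Z \<omega> / d\<rceil>}" by (simp add: less_ceiling_iff zless_nat_eq_int_zless)
    qed simp
    also have "\<dots> \<le> 1 + Z \<omega> / d"
      using nonneg[OF \<omega>] d by simp linarith
    finally show ?thesis .
  qed
  have "(\<Sum>k<n. prob {\<omega> \<in> space M. real k * d < Z \<omega>}) =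
      expectation (\<lambda>\<omega>. \<Sum>k<n. indicator {\<omega> \<in> space M. real k * d < Z \<omega>} \<omega>)"
    by (subst Bochner_Integration.integral_sum) (auto simp: finite_measure.emeasure_finite less_top[symmetric])
  also have "\<dots> \<le> expectation (\<lambda>\<omega>. 1 + Z \<omega> / d)"
    using Z count by (intro integral_mono Bochner_Integration.integrable_sum) (auto simp: less_top[symmetric])
  finally show "(\<Sum>k<n. prob {\<omega> \<in> space M. real k * d < Z \<omega>}) \<le> expectation (\<lambda>\<omega>. 1 + Z \<omega> / d)" .
qed simp

section \<open>Shift invariance and independence for the joint sequence\<close>

locale iid_pairs = prob_space M for M :: "'a measure" +
  fixes A B :: "nat \<Rightarrow> 'a \<Rightarrow> real"
  assumes indep: "indep_vars (\<lambda>_. borel) (\<lambda>i. case i of Inl n \<Rightarrow> A n | Inr n \<Rightarrow> B n) UNIV"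
    and identA: "\<And>n. distr M borel (A n) = distr M borel (A 0)"
    and identB: "\<And>n. distr M borel (B n) = distr M borel (B 0)"
begin

text \<open>Both sequences form one random element indexed by a disjoint sum, so that independence
  of two functionals reduces to disjointness of the coordinates they read.\<close>

definition joint :: "'a \<Rightarrow> nat + nat \<Rightarrow> real" where
  "joint \<omega> i = (case i of Inl n \<Rightarrow> A n \<omega> | Inr n \<Rightarrow> B n \<omega>)"

definition shifted :: "'a \<Rightarrow> nat + nat \<Rightarrow> real" where
  "shifted \<omega> i = joint \<omega> (map_sum Suc Suc i)"

lemma joint_simps [simp]: "joint \<omega> (Inl n) = A n \<omega>" "joint \<omega> (Inr n) = B n \<omega>"
  "shifted \<omega> (Inl n) = A (Suc n) \<omega>" "shifted \<omega> (Inr n) = B (Suc n) \<omega>"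
  by (auto simp: joint_def shifted_def)

abbreviation "seq_space \<equiv> PiM (UNIV :: (nat + nat) set) (\<lambda>_. borel :: real measure)"

lemma case_eq_joint: "(case i of Inl n \<Rightarrow> A n | Inr n \<Rightarrow> B n) = (\<lambda>\<omega>. joint \<omega> i)"
  by (auto simp: joint_def split: sum.split)

lemma indep_joint: "indep_vars (\<lambda>_. borel) (\<lambda>i \<omega>. joint \<omega> i) UNIV"
  using indep by (simp add: case_eq_joint)

lemma joint_measurable [measurable]: "(\<lambda>\<omega>. joint \<omega> i) \<in> borel_measurable M"
  using indep_joint by (auto simp: indep_vars_def)

lemma A_measurable [measurable]: "A n \<in> borel_measurable M"
  using joint_measurable[of "Inl n"] by simp

lemma B_measurable [measurable]: "B n \<in> borel_measurable M"
  using joint_measurable[of "Inr n"] by simp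

lemma joint_measurable_seq [measurable]: "joint \<in> measurable M seq_space"
  by (rule measurable_PiM_single') (auto simp: space_PiM)

lemma shifted_measurable_seq [measurable]: "shifted \<in> measurable M seq_space"
  by (rule measurable_PiM_single') (auto simp: space_PiM shifted_def)

text \<open>The joint law is a product measure, and the shift is an injective reindexing of its
  factors which leaves every marginal unchanged.\<close>

lemma distr_shifted: "distr M seq_space shifted = distr M seq_space joint"
proof -
  define \<mu> where "\<mu> i = distr M borel (\<lambda>\<omega>. joint \<omega> i)" for i
  have \<mu>_shift: "\<mu> (map_sum Suc Suc i) = \<mu> i" for i
    unfolding \<mu>_def using trans[OF identA identA[symmetric]] trans[OF identB identB[symmetric]]
    by (cases i) simp_all
  have sets\<mu>: "sets (\<mu> i) = sets borel" for i by (simp add: \<mu>_def)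
  have setsP: "sets (PiM UNIV \<mu>) = sets seq_space"
    by (rule sets_PiM_cong) (simp_all add: sets\<mu>)
  have joint_eq: "distr M seq_space joint = PiM UNIV \<mu>"
    using indep_vars_iff_distr_eq_PiM[where I = UNIV and M' = "\<lambda>_. borel" and X = "\<lambda>i \<omega>. joint \<omega> i"] indep_joint
    by (simp add: \<mu>_def[abs_def] restrict_UNIV)
  have "distr (PiM UNIV \<mu>) (PiM UNIV (\<lambda>i. \<mu> (map_sum Suc Suc i))) (\<lambda>w. \<lambda>i\<in>UNIV. w (map_sum Suc Suc i))
      = PiM UNIV (\<lambda>i. \<mu> (map_sum Suc Suc i))"
  proof (rule distr_PiM_reindex)
    show "prob_space (\<mu> i)" for i unfolding \<mu>_def by (rule prob_space_distr) measurable
    show "inj_on (map_sum Suc Suc) UNIV"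
      by (simp add: sum.inj_map)
  qed auto
  then have "distr (distr M seq_space joint) seq_space (\<lambda>w i. w (map_sum Suc Suc i)) = PiM UNIV \<mu>"
    unfolding joint_eq \<mu>_shift using distr_cong[OF refl setsP refl, of "PiM UNIV \<mu>"]
    by (simp add: restrict_UNIV)
  moreover have "distr (distr M seq_space joint) seq_space (\<lambda>w i. w (map_sum Suc Suc i)) = distr M seq_space shifted"
    by (subst distr_distr) (auto simp: comp_def shifted_def[abs_def] intro!: measurable_PiM_single')
  ultimately show ?thesis by (simp add: joint_eq)
qed

lemma nn_integral_shifted:
  assumes [measurable]: "F \<in> borel_measurable seq_space"
  shows "(\<integral>\<^sup>+\<omega>. F (shifted \<omega>) \<partial>M) = (\<integral>\<^sup>+\<omega>. F (joint \<omega>) \<partial>M)"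
proof -
  have "(\<integral>\<^sup>+\<omega>. F (shifted \<omega>) \<partial>M) = (\<integral>\<^sup>+w. F w \<partial>distr M seq_space shifted)"
    by (simp add: nn_integral_distr)
  also have "\<dots> = (\<integral>\<^sup>+\<omega>. F (joint \<omega>) \<partial>M)"
    by (simp add: distr_shifted nn_integral_distr)
  finally show ?thesis .
qed

lemma indep_var_joint:
  assumes X: "X \<in> borel_measurable (PiM I (\<lambda>_. borel))" and i: "i \<notin> I"
  shows "indep_var borel (\<lambda>\<omega>. joint \<omega> i) borel (\<lambda>\<omega>. X (restrict (joint \<omega>) I))"
proof -
  have "indep_var (PiM {i} (\<lambda>_. borel)) (\<lambda>\<omega>. restrict (joint \<omega>) {i}) (PiM I (\<lambda>_. borel)) (\<lambda>\<omega>. restrict (joint \<omega>) I)"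
    using indep_var_restrict[OF indep_joint, of "{i}" I] i by simp
  then have "indep_var borel ((\<lambda>w. w i) \<circ> (\<lambda>\<omega>. restrict (joint \<omega>) {i})) borel (X \<circ> (\<lambda>\<omega>. restrict (joint \<omega>) I))"
    by (rule indep_var_compose) (auto intro: X)
  then show ?thesis by (simp add: comp_def)
qed

lemma map_sum_Suc_neq [simp]: "map_sum Suc Suc i \<noteq> Inl 0" "map_sum Suc Suc i \<noteq> Inr 0"
  by (cases i; simp)+

lemma indep_A_shifted:
  assumes F [measurable]: "F \<in> borel_measurable seq_space"
  shows "indep_var borel (A 0) borel (\<lambda>\<omega>. F (shifted \<omega>))"
proof -
  have "(\<lambda>w. F (\<lambda>i. w (map_sum Suc Suc i))) \<in> borel_measurable (PiM (- {Inl 0}) (\<lambda>_. borel))"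
    by (rule measurable_compose[OF _ F], rule measurable_PiM_single')
      (auto simp: space_PiM intro!: measurable_component_singleton)
  from indep_var_joint[OF this, of "Inl 0"] show ?thesis
    by (simp add: shifted_def[abs_def])
qed

text \<open>The product reads \<open>Inl 0\<close> and the shifted coordinates, none of which is
  \<open>Inr 0\<close>.\<close>

lemma indep_B_shifted:
  assumes F [measurable]: "F \<in> borel_measurable seq_space"
  shows "indep_var borel (B 0) borel (\<lambda>\<omega>. A 0 \<omega> * F (shifted \<omega>))"
proof -
  have "(\<lambda>w. F (\<lambda>i. w (map_sum Suc Suc i))) \<in> borel_measurable (PiM (- {Inr 0}) (\<lambda>_. borel))"
    by (rule measurable_compose[OF _ F], rule measurable_PiM_single')
      (auto simp: space_PiM intro!: measurable_component_singleton)
  moreover have "(\<lambda>w. w (Inl 0)) \<in> borel_measurable (PiM (- {Inr 0 :: nat + nat}) (\<lambda>_. borel :: real measure))"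
    by (intro measurable_component_singleton) auto
  ultimately have "(\<lambda>w. w (Inl 0) * F (\<lambda>i. w (map_sum Suc Suc i))) \<in> borel_measurable (PiM (- {Inr 0}) (\<lambda>_. borel))"
    by (intro borel_measurable_times)
  from indep_var_joint[OF this, of "Inr 0"] show ?thesis
    by (simp add: shifted_def[abs_def])
qed

lemma nn_integral_exp_B_plus:
  assumes [measurable]: "F \<in> borel_measurable seq_space"
  shows "(\<integral>\<^sup>+\<omega>. ennreal (exp (t * (B 0 \<omega> + A 0 \<omega> * F (shifted \<omega>)))) \<partial>M) =
    (\<integral>\<^sup>+\<omega>. ennreal (exp (t * B 0 \<omega>)) \<partial>M) * (\<integral>\<^sup>+\<omega>. ennreal (exp (t * (A 0 \<omega> * F (shifted \<omega>)))) \<partial>M)"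
proof -
  have "(\<integral>\<^sup>+\<omega>. ennreal (exp (t * (B 0 \<omega> + A 0 \<omega> * F (shifted \<omega>)))) \<partial>M) =
      (\<integral>\<^sup>+x. \<integral>\<^sup>+\<omega>. ennreal (exp (t * (x + A 0 \<omega> * F (shifted \<omega>)))) \<partial>M \<partial>distr M borel (B 0))"
    using indep_var_nn_integral(1)[OF indep_B_shifted, of F "\<lambda>(x, y). ennreal (exp (t * (x + y)))"] by simp
  also have "\<dots> = (\<integral>\<^sup>+x. ennreal (exp (t * x)) *
      (\<integral>\<^sup>+\<omega>. ennreal (exp (t * (A 0 \<omega> * F (shifted \<omega>)))) \<partial>M) \<partial>distr M borel (B 0))"
    by (intro nn_integral_cong) (simp add: distrib_left exp_add ennreal_mult nn_integral_cmult)
  also have "\<dots> = (\<integral>\<^sup>+x. ennreal (exp (t * x)) \<partial>distr M borel (B 0)) *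
      (\<integral>\<^sup>+\<omega>. ennreal (exp (t * (A 0 \<omega> * F (shifted \<omega>)))) \<partial>M)"
    by (rule nn_integral_multc) simp
  finally show ?thesis by (simp add: nn_integral_distr)
qed

text \<open>With \<open>A 0\<close> frozen at \<open>a\<close>, the shifted sequence may be replaced
  by the original one, which has the same law. This replacement makes the recursion close.\<close>

lemma nn_integral_exp_A_mult:
  assumes [measurable]: "F \<in> borel_measurable seq_space"
  shows "(\<integral>\<^sup>+\<omega>. ennreal (exp (t * (A 0 \<omega> * F (shifted \<omega>)))) \<partial>M) =
    (\<integral>\<^sup>+a. (\<integral>\<^sup>+\<omega>. ennreal (exp (t * a * F (joint \<omega>))) \<partial>M) \<partial>distr M borel (A 0))"
proof -
  have "(\<integral>\<^sup>+\<omega>. ennreal (exp (t * (A 0 \<omega> * F (shifted \<omega>)))) \<partial>M) =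
      (\<integral>\<^sup>+a. \<integral>\<^sup>+\<omega>. ennreal (exp (t * (a * F (shifted \<omega>)))) \<partial>M \<partial>distr M borel (A 0))"
    using indep_var_nn_integral(1)[OF indep_A_shifted, of F "\<lambda>(x, y). ennreal (exp (t * (x * y)))"] by simp
  also have "\<dots> = (\<integral>\<^sup>+a. \<integral>\<^sup>+\<omega>. ennreal (exp (t * (a * F (joint \<omega>)))) \<partial>M \<partial>distr M borel (A 0))"
    by (intro nn_integral_cong nn_integral_shifted) measurable
  finally show ?thesis by (simp add: mult.assoc)
qed

section \<open>Almost sure convergence of the series\<close>

definition series :: "(nat + nat \<Rightarrow> real) \<Rightarrow> real" where
  "series w = (\<Sum>k. (\<Prod>i<k. w (Inl i)) * w (Inr k))"

definition partial_series :: "nat \<Rightarrow> (nat + nat \<Rightarrow> real) \<Rightarrow> real" where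
  "partial_series n w = (\<Sum>k<n. (\<Prod>i<k. w (Inl i)) * w (Inr k))"

lemma series_measurable [measurable]: "series \<in> borel_measurable seq_space"
  unfolding series_def[abs_def] by measurable

lemma partial_series_measurable [measurable]: "partial_series n \<in> borel_measurable seq_space"
  unfolding partial_series_def[abs_def] by measurable

lemma perpetuity_eq_series: "perpetuity A B \<omega> = series (joint \<omega>)"
  by (simp add: perpetuity_def series_def)

lemma partial_series_Suc:
  "partial_series (Suc n) (joint \<omega>) = B 0 \<omega> + A 0 \<omega> * partial_series n (shifted \<omega>)"
  by (simp add: partial_series_def sum.lessThan_Suc_shift prod.lessThan_Suc_shift sum_distrib_left mult.assoc
      del: sum.lessThan_Suc prod.lessThan_Suc)

text \<open>The products decay geometrically in mean, while the logarithmic moment lets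
  \<open>B k\<close> grow at most like \<open>d ^ k\<close> for any \<open>d > 1\<close>. A rate
  \<open>d\<close> slightly above 1 leaves room for both.\<close>

lemma AE_summable_of_log_integrable:
  assumes A01: "AE \<omega> in M. 0 < A 0 \<omega> \<and> A 0 \<omega> < 1"
    and logint: "integrable M (\<lambda>\<omega>. ln (1 + \<bar>B 0 \<omega>\<bar>))"
  shows "AE \<omega> in M. summable (\<lambda>k. (\<Prod>i<k. A i \<omega>) * B k \<omega>)"
proof -
  define q where "q = expectation (A 0)"
  have intA: "integrable M (A 0)"
    by (rule integrable_const_bound[where B = 1]) (use A01 in \<open>auto elim: eventually_mono\<close>)
  have q: "0 \<le> q" "q < 1"
    unfolding q_def using A01
    by (auto intro!: integral_nonneg_AE expectation_less[OF intA] elim!: eventually_mono)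
  have A_n: "AE \<omega> in M. 0 < A n \<omega> \<and> A n \<omega> < 1" for n
  proof -
    have "AE x in distr M borel (A n). 0 < x \<and> x < 1"
      unfolding identA[of n] using A01 by (subst AE_distr_iff) auto
    then show ?thesis by (subst (asm) AE_distr_iff) auto
  qed
  have nnA: "(\<integral>\<^sup>+\<omega>. ennreal (A n \<omega>) \<partial>M) = ennreal q" for n
  proof -
    have "(\<integral>\<^sup>+\<omega>. ennreal (A n \<omega>) \<partial>M) = (\<integral>\<^sup>+x. ennreal x \<partial>distr M borel (A n))"
      by (simp add: nn_integral_distr)
    also have "\<dots> = (\<integral>\<^sup>+\<omega>. ennreal (A 0 \<omega>) \<partial>M)"
      by (simp add: identA[of n] nn_integral_distr)
    also have "\<dots> = ennreal q"
      unfolding q_def using A01 by (intro nn_integral_eq_integral intA) (auto elim: eventually_mono)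
    finally show ?thesis .
  qed
  have prodA: "(\<integral>\<^sup>+\<omega>. (\<Prod>i<k. ennreal (A i \<omega>)) \<partial>M) = ennreal q ^ k" for k
  proof -
    have "indep_vars (\<lambda>_. borel) (\<lambda>i \<omega>. ennreal (joint \<omega> i)) (Inl ` {..<k})"
      by (rule indep_vars_compose2[OF indep_vars_subset[OF indep_joint]]) auto
    then have "(\<integral>\<^sup>+\<omega>. (\<Prod>i\<in>Inl ` {..<k}. ennreal (joint \<omega> i)) \<partial>M) =
        (\<Prod>i\<in>Inl ` {..<k}. \<integral>\<^sup>+\<omega>. ennreal (joint \<omega> i) \<partial>M)"
      by (intro indep_vars_nn_integral) auto
    then show ?thesis by (simp add: prod.reindex nnA)
  qed
  \<comment> \<open>Then \<open>d > 1\<close> and \<open>q * d = 2 * q / (1 + q) < 1\<close>, both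
    because \<open>q < 1\<close>.\<close>
  define d where "d = 2 / (1 + q)"
  have d: "d > 1" "q * d < 1" using q by (auto simp: d_def field_simps)
  have "(\<integral>\<^sup>+\<omega>. (\<Sum>k. ennreal (d ^ k) * (\<Prod>i<k. ennreal (A i \<omega>))) \<partial>M) =
      (\<Sum>k. ennreal (d ^ k) * ennreal q ^ k)"
    by (subst nn_integral_suminf) (auto simp: nn_integral_cmult prodA)
  also have "\<dots> = (\<Sum>k. ennreal ((q * d) ^ k))"
    using q d by (intro suminf_cong) (simp add: ennreal_power ennreal_mult[symmetric] power_mult_distrib mult.commute)
  also have "\<dots> < \<infinity>"
    using q d by (subst suminf_ennreal2) (auto intro!: summable_geometric simp: abs_mult)
  finally have "AE \<omega> in M. (\<Sum>k. ennreal (d ^ k) * (\<Prod>i<k. ennreal (A i \<omega>))) \<noteq> \<infinity>"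
    by (intro nn_integral_noteq_infinite) auto
  moreover have "AE \<omega> in M. \<forall>n. 0 < A n \<omega> \<and> A n \<omega> < 1"
    using A_n by (subst AE_all_countable) auto
  moreover have "AE \<omega> in M. \<forall>\<^sub>F k in sequentially. \<bar>B k \<omega>\<bar> \<le> d ^ k"
  proof -
    have "AE \<omega> in M. \<forall>\<^sub>F k in sequentially. \<omega> \<in> space M - {\<omega> \<in> space M. d ^ k < \<bar>B k \<omega>\<bar>}"
    proof (rule borel_cantelli_AE1)
      have le: "prob {\<omega> \<in> space M. d ^ k < \<bar>B k \<omega>\<bar>} \<le> prob {\<omega> \<in> space M. real k * ln d < ln (1 + \<bar>B 0 \<omega>\<bar>)}" for k
      proof -
        have "prob {\<omega> \<in> space M. d ^ k < \<bar>B k \<omega>\<bar>} = measure (distr M borel (B k)) {x. d ^ k < \<bar>x\<bar>}"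
          by (subst measure_distr) (auto simp: vimage_def Int_def conj_commute)
        also have "\<dots> = prob {\<omega> \<in> space M. d ^ k < \<bar>B 0 \<omega>\<bar>}"
          unfolding identB[of k] by (subst measure_distr) (auto simp: vimage_def Int_def conj_commute)
        also have "\<dots> \<le> prob {\<omega> \<in> space M. real k * ln d < ln (1 + \<bar>B 0 \<omega>\<bar>)}"
        proof (rule finite_measure_mono)
          show "{\<omega> \<in> space M. d ^ k < \<bar>B 0 \<omega>\<bar>} \<subseteq> {\<omega> \<in> space M. real k * ln d < ln (1 + \<bar>B 0 \<omega>\<bar>)}"
          proof safe
            fix \<omega> assume *: "d ^ k < \<bar>B 0 \<omega>\<bar>"
            have "real k * ln d = ln (d ^ k)" using d by (simp add: ln_realpow)
            also have "\<dots> < ln (1 + \<bar>B 0 \<omega>\<bar>)" using * d by (subst ln_less_cancel_iff) auto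
            finally show "real k * ln d < ln (1 + \<bar>B 0 \<omega>\<bar>)" .
          qed
        qed measurable
        finally show ?thesis .
      qed
      show "summable (\<lambda>k. prob {\<omega> \<in> space M. d ^ k < \<bar>B k \<omega>\<bar>})"
        by (rule summable_comparison_test'[OF summable_prob_multiples[OF logint, of "ln d"]])
          (use d le in auto)
    qed (auto simp: less_top[symmetric])
    then show ?thesis by eventually_elim (auto elim!: eventually_mono)
  qed
  ultimately show ?thesis
  proof eventually_elim
    case (elim \<omega>)
    have nonneg: "0 \<le> (\<Prod>i<k. A i \<omega>)" for k
      using elim(2) by (intro prod_nonneg) (auto intro: less_imp_le)
    have "ennreal (d ^ k) * (\<Prod>i<k. ennreal (A i \<omega>)) = ennreal (d ^ k * (\<Prod>i<k. A i \<omega>))" for k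
      using elim(2) d nonneg by (subst prod_ennreal) (auto simp: ennreal_mult intro: less_imp_le)
    then have "(\<Sum>k. ennreal (d ^ k * (\<Prod>i<k. A i \<omega>))) \<noteq> \<infinity>"
      using elim(1) by simp
    then have "summable (\<lambda>k. d ^ k * (\<Prod>i<k. A i \<omega>))"
      using d nonneg by (intro summable_suminf_not_top) auto
    then show ?case
    proof (rule summable_comparison_test_ev[rotated])
      show "\<forall>\<^sub>F k in sequentially. norm ((\<Prod>i<k. A i \<omega>) * B k \<omega>) \<le> d ^ k * (\<Prod>i<k. A i \<omega>)"
        using elim(3)
      proof eventually_elim
        case (elim k)
        have "(\<Prod>i<k. A i \<omega>) * \<bar>B k \<omega>\<bar> \<le> (\<Prod>i<k. A i \<omega>) * d ^ k"
          using elim nonneg by (intro mult_left_mono) auto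
        then show ?case using nonneg[of k] by (simp add: abs_mult mult.commute)
      qed
    qed
  qed
qed

end

section \<open>Recursion and exponential moments for beta factors\<close>

locale beta_pairs = iid_pairs +
  fixes lam :: real
  assumes lam_pos: "lam > 0"
    and betaA: "distributed M lborel (A 0) (\<lambda>x. ennreal (indicator {0<..<1} x * lam * x powr (lam - 1)))"
    and log_integrable: "integrable M (\<lambda>\<omega>. ln (1 + \<bar>B 0 \<omega>\<bar>))"
begin

lemma nn_integral_A:
  assumes "g \<in> borel_measurable borel"
  shows "(\<integral>\<^sup>+a. g a \<partial>distr M borel (A 0)) =
    (\<integral>\<^sup>+a. ennreal (indicator {0<..<1} a * lam * a powr (lam - 1)) * g a \<partial>lborel)"
proof -
  have "distr M borel (A 0) = distr M lborel (A 0)" by (rule distr_cong) auto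
  also have "\<dots> = density lborel (\<lambda>x. ennreal (indicator {0<..<1} x * lam * x powr (lam - 1)))"
    using betaA by (simp add: distributed_distr_eq_density)
  finally show ?thesis using assms by (simp add: nn_integral_density)
qed

lemma AE_A: "AE \<omega> in M. 0 < A 0 \<omega> \<and> A 0 \<omega> < 1"
proof -
  have "AE x in distr M lborel (A 0). 0 < x \<and> x < 1"
    unfolding distributed_distr_eq_density[OF betaA, symmetric, THEN sym]
    by (subst AE_density) (auto split: split_indicator)
  then show ?thesis by (subst (asm) AE_distr_iff) auto
qed

lemma AE_summable: "AE \<omega> in M. summable (\<lambda>k. (\<Prod>i<k. A i \<omega>) * B k \<omega>)"
  by (rule AE_summable_of_log_integrable[OF AE_A log_integrable])

text \<open>This is \<open>Y\<close> of the overview, written through \<open>shifted\<close> rather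
  than as the difference of \<open>X\<close> and \<open>B 0\<close>, which makes its independence of
  \<open>B 0\<close> a statement about coordinates.\<close>

definition remainder :: "'a \<Rightarrow> real" where
  "remainder \<omega> = A 0 \<omega> * series (shifted \<omega>)"

lemma remainder_measurable [measurable]: "remainder \<in> borel_measurable M"
  unfolding remainder_def[abs_def] by measurable

lemma indep_B_remainder: "indep_var borel (B 0) borel remainder"
  unfolding remainder_def[abs_def] by (rule indep_B_shifted) measurable

lemma AE_perpetuity_decomposition:
  "AE \<omega> in M. perpetuity A B \<omega> = B 0 \<omega> + remainder \<omega> \<and>
     (\<lambda>n. partial_series n (shifted \<omega>)) \<longlonglongrightarrow> series (shifted \<omega>)"
  using AE_summable AE_A
proof eventually_elim
  case (elim \<omega>)
  define c where "c k = (\<Prod>i<k. A (Suc i) \<omega>) * B (Suc k) \<omega>" for k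
  have Suc_eq: "(\<Prod>i<Suc k. A i \<omega>) * B (Suc k) \<omega> = A 0 \<omega> * c k" for k
    by (simp add: c_def prod.lessThan_Suc_shift mult.assoc del: prod.lessThan_Suc)
  have "summable (\<lambda>k. (\<Prod>i<Suc k. A i \<omega>) * B (Suc k) \<omega>)"
    using elim(1) by (subst summable_Suc_iff)
  then have c: "summable c"
    unfolding Suc_eq using elim(2) by (simp add: summable_cmult_iff)
  have "perpetuity A B \<omega> = (\<Sum>k. (\<Prod>i<Suc k. A i \<omega>) * B (Suc k) \<omega>) + B 0 \<omega>"
    unfolding perpetuity_def using suminf_split_head[OF elim(1)] by simp
  also have "\<dots> = A 0 \<omega> * suminf c + B 0 \<omega>"
    unfolding Suc_eq using c by (simp add: suminf_mult)
  finally have "perpetuity A B \<omega> = B 0 \<omega> + remainder \<omega>"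
    by (simp add: remainder_def series_def c_def[abs_def])
  moreover have "(\<lambda>n. partial_series n (shifted \<omega>)) \<longlonglongrightarrow> series (shifted \<omega>)"
    using summable_LIMSEQ[OF c] by (simp add: partial_series_def series_def c_def[abs_def])
  ultimately show ?case by simp
qed

text \<open>Conditioning on \<open>A 0 = a\<close> leaves a copy of the whole perpetuity scaled by
  \<open>a\<close>, which factors into \<open>B 0\<close> and an independent remainder. The
  integrals may be infinite, so this holds before any exponential moment is known.\<close>

lemma nn_integral_exp_remainder:
  "(\<integral>\<^sup>+\<omega>. ennreal (exp (u * remainder \<omega>)) \<partial>M) =
    (\<integral>\<^sup>+a. ennreal (indicator {0<..<1} a * lam * a powr (lam - 1)) *
      ((\<integral>\<^sup>+\<omega>. ennreal (exp (u * a * B 0 \<omega>)) \<partial>M) * (\<integral>\<^sup>+\<omega>. ennreal (exp (u * a * remainder \<omega>)) \<partial>M)) \<partial>lborel)"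
proof -
  have "(\<integral>\<^sup>+\<omega>. ennreal (exp (v * series (joint \<omega>))) \<partial>M) =
      (\<integral>\<^sup>+\<omega>. ennreal (exp (v * (B 0 \<omega> + A 0 \<omega> * series (shifted \<omega>)))) \<partial>M)" for v
    using AE_perpetuity_decomposition
    by (intro nn_integral_cong_AE) (auto simp: perpetuity_eq_series[symmetric] remainder_def elim: eventually_mono)
  then have "(\<integral>\<^sup>+\<omega>. ennreal (exp (v * series (joint \<omega>))) \<partial>M) =
      (\<integral>\<^sup>+\<omega>. ennreal (exp (v * B 0 \<omega>)) \<partial>M) * (\<integral>\<^sup>+\<omega>. ennreal (exp (v * remainder \<omega>)) \<partial>M)" for v
    by (simp add: nn_integral_exp_B_plus remainder_def)
  then show ?thesis
    unfolding remainder_def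
    by (subst nn_integral_exp_A_mult) (simp_all add: nn_integral_A remainder_def)
qed

text \<open>The integrand is the derivative of
  \<open>a powr lam * exp (lam * k * a)\<close>.\<close>

lemma nn_integral_beta_exp:
  assumes k: "k \<ge> 0"
  shows "(\<integral>\<^sup>+a. ennreal (indicator {0<..<1} a * lam * a powr (lam - 1)) *
      ennreal ((1 + k * a) * exp (lam * k * a)) \<partial>lborel) = ennreal (exp (lam * k))"
proof -
  define f where "f a = lam * a powr (lam - 1) * ((1 + k * a) * exp (lam * k * a))" for a
  define G where "G a = a powr lam * exp (lam * k * a)" for a
  have f_nonneg: "f a \<ge> 0" if "0 < a" for a using that k lam_pos by (simp add: f_def)
  have "((\<lambda>a. a powr lam * exp (lam * k * a)) \<longlongrightarrow> 0 powr lam * exp (lam * k * 0)) (at_right 0)"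
    using lam_pos by (intro tendsto_intros) (auto simp: eventually_at_filter)
  then have lim0: "(G \<longlongrightarrow> 0) (at_right 0)" using lam_pos by (simp add: G_def[abs_def])
  have "((\<lambda>a. a powr lam * exp (lam * k * a)) \<longlongrightarrow> 1 powr lam * exp (lam * k * 1)) (at_left 1)"
    by (intro tendsto_intros) auto
  then have lim1: "(G \<longlongrightarrow> exp (lam * k)) (at_left 1)" by (simp add: G_def[abs_def])
  have deriv: "(G has_real_derivative f x) (at x)" if "0 < x" for x
    unfolding G_def[abs_def] f_def using that
    by (auto intro!: derivative_eq_intros simp: powr_diff field_simps)
  have cont: "isCont f x" if "0 < x" for x
    unfolding f_def[abs_def] using that by (intro continuous_intros) auto
  \<comment> \<open>For \<open>lam < 1\<close> the integrand is singular at 0, hence the improper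
    form with one-sided limits of the primitive.\<close>
  have *: "set_integrable lborel (einterval (ereal 0) (ereal 1)) f" "(LBINT x=ereal 0..ereal 1. f x) = exp (lam * k) - 0"
    by (rule interval_integral_FTC_nonneg[where F = G];
        use deriv cont lim0 lim1 f_nonneg in \<open>simp add: ereal_tendsto_simps\<close>)+
  have "(\<integral>\<^sup>+a. ennreal (indicator {0<..<1} a * lam * a powr (lam - 1)) *
      ennreal ((1 + k * a) * exp (lam * k * a)) \<partial>lborel) = (\<integral>\<^sup>+a. ennreal (indicator {0<..<1} a *\<^sub>R f a) \<partial>lborel)"
    using k lam_pos by (intro nn_integral_cong) (auto simp: f_def ennreal_mult[symmetric] split: split_indicator)
  also have "\<dots> = ennreal (exp (lam * k))"
    using * f_nonneg
    by (subst nn_integral_eq_integral)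
      (auto simp: set_integrable_def set_lebesgue_integral_def interval_lebesgue_integral_def einterval_eq
        split: split_indicator)
  finally show ?thesis .
qed

text \<open>The bound \<open>exp (lam * (c * u))\<close> is the exact fixed point of the recursion for the
  exponential moments of the remainder if the moment generating function of \<open>B 0\<close> is replaced by
  \<open>1 + c * v\<close>; this lets the induction over the partial sums close.\<close>

lemma nn_integral_exp_remainder_le:
  assumes c: "c \<ge> 0"
    and B: "\<And>v. 0 < v \<Longrightarrow> v \<le> t \<Longrightarrow> (\<integral>\<^sup>+\<omega>. ennreal (exp (v * B 0 \<omega>)) \<partial>M) \<le> ennreal (1 + c * v)"
    and u: "0 < u" "u \<le> t"
  shows "(\<integral>\<^sup>+\<omega>. ennreal (exp (u * remainder \<omega>)) \<partial>M) \<le> ennreal (exp (lam * (c * u)))"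
proof -
  define Y where "Y n \<omega> = A 0 \<omega> * partial_series n (shifted \<omega>)" for n \<omega>
  have [measurable]: "Y n \<in> borel_measurable M" for n unfolding Y_def[abs_def] by measurable
  have Y_le: "(\<integral>\<^sup>+\<omega>. ennreal (exp (v * Y n \<omega>)) \<partial>M) \<le> ennreal (exp (lam * (c * v)))" if "0 < v" "v \<le> t" for n v
    using that
  \<comment> \<open>The recursion evaluates the previous bound at \<open>v * a\<close>, so it must
    be available at all exponents up to \<open>t\<close> at once.\<close>
  proof (induction n arbitrary: v)
    case 0
    then show ?case using c lam_pos by (simp add: Y_def partial_series_def emeasure_space_1)
  next
    case (Suc n)
    have "(\<integral>\<^sup>+\<omega>. ennreal (exp (v * Y (Suc n) \<omega>)) \<partial>M) =
        (\<integral>\<^sup>+a. ennreal (indicator {0<..<1} a * lam * a powr (lam - 1)) *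
          ((\<integral>\<^sup>+\<omega>. ennreal (exp (v * a * B 0 \<omega>)) \<partial>M) * (\<integral>\<^sup>+\<omega>. ennreal (exp (v * a * Y n \<omega>)) \<partial>M)) \<partial>lborel)"
      unfolding Y_def
      by (subst nn_integral_exp_A_mult) (simp_all add: nn_integral_A partial_series_Suc nn_integral_exp_B_plus)
    also have "\<dots> \<le> (\<integral>\<^sup>+a. ennreal (indicator {0<..<1} a * lam * a powr (lam - 1)) *
          ennreal ((1 + c * v * a) * exp (lam * (c * v) * a)) \<partial>lborel)"
    proof (rule nn_integral_mono)
      fix a :: real
      show "ennreal (indicator {0<..<1} a * lam * a powr (lam - 1)) *
          ((\<integral>\<^sup>+\<omega>. ennreal (exp (v * a * B 0 \<omega>)) \<partial>M) * (\<integral>\<^sup>+\<omega>. ennreal (exp (v * a * Y n \<omega>)) \<partial>M))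
          \<le> ennreal (indicator {0<..<1} a * lam * a powr (lam - 1)) *
          ennreal ((1 + c * v * a) * exp (lam * (c * v) * a))"
      proof (cases "0 < a \<and> a < 1")
        case True
        then have va: "0 < v * a" "v * a \<le> t" using Suc.prems by (auto intro: order_trans[of _ v])
        have "(\<integral>\<^sup>+\<omega>. ennreal (exp (v * a * B 0 \<omega>)) \<partial>M) * (\<integral>\<^sup>+\<omega>. ennreal (exp (v * a * Y n \<omega>)) \<partial>M)
            \<le> ennreal (1 + c * (v * a)) * ennreal (exp (lam * (c * (v * a))))"
          by (intro mult_mono B Suc.IH va) auto
        also have "\<dots> = ennreal ((1 + c * v * a) * exp (lam * (c * v) * a))"
          using va c mult_nonneg_nonneg[of c "v * a"] by (subst ennreal_mult[symmetric]) (auto simp: mult_ac)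
        finally show ?thesis by (rule mult_left_mono) auto
      qed (auto split: split_indicator)
    qed
    also have "\<dots> = ennreal (exp (lam * (c * v)))"
      using c Suc.prems by (intro nn_integral_beta_exp) auto
    finally show ?case .
  qed
  \<comment> \<open>The partial sums converge almost surely but no integrable majorant is at hand;
    the uniform bound passes to the limit by Fatou.\<close>
  have "(\<integral>\<^sup>+\<omega>. ennreal (exp (u * remainder \<omega>)) \<partial>M) = (\<integral>\<^sup>+\<omega>. liminf (\<lambda>n. ennreal (exp (u * Y n \<omega>))) \<partial>M)"
  proof (rule nn_integral_cong_AE)
    show "AE \<omega> in M. ennreal (exp (u * remainder \<omega>)) = liminf (\<lambda>n. ennreal (exp (u * Y n \<omega>)))"
      using AE_perpetuity_decomposition
    proof eventually_elim
      case (elim \<omega>)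
      then have "(\<lambda>n. ennreal (exp (u * Y n \<omega>))) \<longlonglongrightarrow> ennreal (exp (u * remainder \<omega>))"
        unfolding Y_def remainder_def by (intro tendsto_intros) auto
      then show ?case by (intro lim_imp_Liminf[symmetric]) auto
    qed
  qed
  also have "\<dots> \<le> liminf (\<lambda>n. \<integral>\<^sup>+\<omega>. ennreal (exp (u * Y n \<omega>)) \<partial>M)"
    by (rule nn_integral_liminf) measurable
  also have "\<dots> \<le> ennreal (exp (lam * (c * u)))"
    using Y_le[OF u] by (intro Liminf_le) (auto intro!: always_eventually)
  finally show ?thesis .
qed

end

text \<open>\<open>C\<close> is contributed by the tail of \<open>B 0\<close>,
  \<open>b powr a * exp (lam * E b)\<close> by the explicit transform of the remainder near
  \<open>b\<close>, and \<open>Gamma (a + 1)\<close> by Karamata.\<close>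

lemma (in beta_pairs) perpetuity_tail_limit:
  assumes B: "exponential_tail (distr M borel (B 0)) C b"
  defines "a \<equiv> lam * C"
    and "E \<equiv> exponential_tail.defect_exponent (distr M borel (B 0)) C b"
  shows "((\<lambda>x. prob {\<omega> \<in> space M. perpetuity A B \<omega> > x} / (x powr a * exp (- b * x)))
           \<longlongrightarrow> C * (b powr a * exp (lam * E b) / Gamma (a + 1))) at_top"
proof -
  interpret B: exponential_tail "distr M borel (B 0)" C b by (rule B)
  define N where "N = distr M borel remainder"
  interpret N: real_distribution N unfolding N_def by (rule real_distribution_distr) measurable
  have N: "real_distribution N" ..
  have a: "a > 0" using lam_pos B.C_pos by (simp add: a_def)
  have nn_B: "(\<integral>\<^sup>+\<omega>. ennreal (exp (t * B 0 \<omega>)) \<partial>M) = (\<integral>\<^sup>+z. ennreal (exp (t * z)) \<partial>distr M borel (B 0))" for t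
    by (simp add: nn_integral_distr)
  have nn_N: "(\<integral>\<^sup>+\<omega>. ennreal (exp (t * remainder \<omega>)) \<partial>M) = (\<integral>\<^sup>+y. ennreal (exp (t * y)) \<partial>N)" for t
    by (simp add: N_def nn_integral_distr)
  \<comment> \<open>Finiteness on \<open>(0, b)\<close> comes first, since the differential equation
    concerns a finite transform; the linear bound on the transform of \<open>B 0\<close> up to
    \<open>t\<close> starts the moment estimate.\<close>
  have int: "integrable N (\<lambda>y. exp (t * y))" if t: "0 < t" "t < b" for t
  proof -
    obtain c where c: "c \<ge> 0" "\<And>v. 0 < v \<Longrightarrow> v \<le> t \<Longrightarrow> B.mgf v \<le> 1 + c * v"
      using B.mgf_linear_bound[OF t] by blast
    have "(\<integral>\<^sup>+\<omega>. ennreal (exp (v * B 0 \<omega>)) \<partial>M) \<le> ennreal (1 + c * v)" if "0 < v" "v \<le> t" for v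
      using that t c(2)[of v] by (simp add: nn_B B.mgf_eq(3) ennreal_leI)
    then have "(\<integral>\<^sup>+\<omega>. ennreal (exp (t * remainder \<omega>)) \<partial>M) \<le> ennreal (exp (lam * (c * t)))"
      using t c(1) by (intro nn_integral_exp_remainder_le[where t = t]) auto
    also have "\<dots> < \<infinity>" by simp
    finally show ?thesis
      by (intro integrableI_nonneg) (auto simp: nn_N)
  qed
  have mgf_N: "(LINT y|N. exp (u * y)) = (b / (b - u)) powr a * exp (lam * E u)" if "0 < u" "u < b" for u
    unfolding a_def E_def
  proof (rule B.solution_of_beta_fixed_point[OF N lam_pos int])
    show "(\<integral>\<^sup>+y. ennreal (exp (u * y)) \<partial>N) =
      (\<integral>\<^sup>+a. ennreal (indicator {0<..<1} a * lam * a powr (lam - 1)) *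
        ((\<integral>\<^sup>+z. ennreal (exp (u * a * z)) \<partial>distr M borel (B 0)) * (\<integral>\<^sup>+y. ennreal (exp (u * a * y)) \<partial>N)) \<partial>lborel)" for u
      using nn_integral_exp_remainder[of u] by (simp only: nn_B nn_N)
  qed (use that in auto)
  \<comment> \<open>At \<open>u = b - s\<close> the singular factor is
    \<open>(b / s) powr a\<close>, so \<open>s powr a\<close> cancels it and only continuity of the
    exponent at \<open>b\<close> from the left remains.\<close>
  have "((\<lambda>s. b powr a * exp (lam * E (b - s))) \<longlongrightarrow> b powr a * exp (lam * E b)) (at_right 0)"
  proof -
    have "filterlim (\<lambda>s. b - s) (at_left b) (at_right 0)"
      by (auto simp: filterlim_at eventually_at_filter intro!: tendsto_eq_intros)
    then show ?thesis
      unfolding E_def by (intro tendsto_intros filterlim_compose[OF B.defect_exponent_at_b])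
  qed
  then have lim: "((\<lambda>s. s powr a * (LINT y|N. exp ((b - s) * y))) \<longlongrightarrow> b powr a * exp (lam * E b)) (at_right 0)"
  proof (rule Lim_transform_eventually)
    show "\<forall>\<^sub>F s in at_right 0. b powr a * exp (lam * E (b - s)) = s powr a * (LINT y|N. exp ((b - s) * y))"
      using eventually_at_right_real[OF B.b_pos]
    proof eventually_elim
      case (elim s)
      then show ?case using mgf_N[of "b - s"] by (simp add: powr_divide)
    qed
  qed
  have prob_eq: "prob {\<omega> \<in> space M. perpetuity A B \<omega> > x} = (LINT y|N. measure (distr M borel (B 0)) {x - y<..})" for x
  proof -
    have [measurable]: "perpetuity A B \<in> borel_measurable M"
      unfolding perpetuity_def[abs_def] by measurable
    have tail_le_1: "measure (distr M borel (B 0)) S \<le> 1" for S by (rule B.prob_le_1)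
    have "ennreal (prob {\<omega> \<in> space M. perpetuity A B \<omega> > x}) =
        (\<integral>\<^sup>+\<omega>. indicator {\<omega> \<in> space M. perpetuity A B \<omega> > x} \<omega> \<partial>M)"
      by (simp add: emeasure_eq_measure)
    also have "\<dots> = (\<integral>\<^sup>+\<omega>. indicator {x<..} (perpetuity A B \<omega>) \<partial>M)"
      by (intro nn_integral_cong) (auto split: split_indicator)
    also have "\<dots> = (\<integral>\<^sup>+\<omega>. (case (B 0 \<omega>, remainder \<omega>) of (z, y) \<Rightarrow> indicator {x<..} (z + y)) \<partial>M)"
      using AE_perpetuity_decomposition by (intro nn_integral_cong_AE) (auto elim: eventually_mono)
    also have "\<dots> = (\<integral>\<^sup>+y. \<integral>\<^sup>+\<omega>. indicator {x<..} (B 0 \<omega> + y) \<partial>M \<partial>N)"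
      unfolding N_def by (subst indep_var_nn_integral(2)[OF indep_B_remainder]) auto
    also have "\<dots> = (\<integral>\<^sup>+y. ennreal (measure (distr M borel (B 0)) {x - y<..}) \<partial>N)"
    proof (rule nn_integral_cong)
      fix y
      have "(\<integral>\<^sup>+\<omega>. indicator {x<..} (B 0 \<omega> + y) \<partial>M) = (\<integral>\<^sup>+z. indicator {x - y<..} z \<partial>distr M borel (B 0))"
        by (subst nn_integral_distr) (auto intro!: nn_integral_cong split: split_indicator)
      then show "(\<integral>\<^sup>+\<omega>. indicator {x<..} (B 0 \<omega> + y) \<partial>M) = ennreal (measure (distr M borel (B 0)) {x - y<..})"
        by (simp add: B.emeasure_eq_measure)
    qed
    also have "\<dots> = ennreal (LINT y|N. measure (distr M borel (B 0)) {x - y<..})"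
      by (intro nn_integral_eq_integral N.integrable_const_bound[where B = 1])
        (auto simp: tail_le_1)
    finally show ?thesis by (subst (asm) ennreal_inj) (auto intro!: integral_nonneg_AE)
  qed
  have "((\<lambda>x. exp (b * x) * prob {\<omega> \<in> space M. perpetuity A B \<omega> > x} / x powr a)
      \<longlongrightarrow> C * (b powr a * exp (lam * E b) / Gamma (a + 1))) at_top"
    unfolding prob_eq by (rule B.convolution_tail_asymptotics[OF N a int lim])
  then show ?thesis by (simp add: exp_minus divide_simps mult.commute)
qed

theorem theorem2p6:
  fixes M :: "'a measure" and A B :: "nat \<Rightarrow> 'a \<Rightarrow> real"
    and lam C b eps :: real and r :: "real \<Rightarrow> real"
  assumes "prob_space M"
    and indep: "prob_space.indep_vars M (\<lambda>_. borel)
                  (\<lambda>i. case i of Inl n \<Rightarrow> A n | Inr n \<Rightarrow> B n) UNIV"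
    and identA: "\<And>n. distr M borel (A n) = distr M borel (A 0)"
    and identB: "\<And>n. distr M borel (B n) = distr M borel (B 0)"
    and lam_pos: "lam > 0"
    and betaA: "distributed M lborel (A 0)
                  (\<lambda>x. ennreal (indicator {0<..<1} x * lam * x powr (lam - 1)))"
    and logmom: "integrable M (\<lambda>\<omega>. ln (1 + max 0 (- B 0 \<omega>)))"
    and C_pos: "C > 0" and b_pos: "b > 0"
    and tail: "\<And>x. x \<ge> 0 \<Longrightarrow>
                 measure M {\<omega> \<in> space M. B 0 \<omega> > x} = C * exp (- b * x) + r x"
    and r_lim: "((\<lambda>x. exp (b * x) * r x) \<longlongrightarrow> 0) at_top"
    and eps_pos: "eps > 0"
    and r_plus: "set_integrable lborel {1..} (\<lambda>y. exp (b * y) / y * max 0 (r y))"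
    and r_minus: "set_integrable lborel {1..} (\<lambda>y. exp ((b + eps) * y) / y * max 0 (- r y))"
  shows "set_integrable lborel {0<..} (\<lambda>y. (exp (b * y) - 1) / y * r y)
       \<and> set_integrable lborel {..<0}
           (\<lambda>y. (exp (b * y) - 1) / y * measure M {\<omega> \<in> space M. B 0 \<omega> \<le> y})
       \<and> (\<lambda>x. measure M {\<omega> \<in> space M. perpetuity A B \<omega> > x})
           \<sim>[at_top]
         (\<lambda>x. (C * b powr (C * lam) / Gamma (C * lam + 1)
                * exp (lam * ((LINT y:{0<..}|lborel. (exp (b * y) - 1) / y * r y)
                   - (LINT y:{..<0}|lborel.
                        (exp (b * y) - 1) / y * measure M {\<omega> \<in> space M. B 0 \<omega> \<le> y}))))
              * x powr (lam * C) * exp (- b * x))"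
proof -
  interpret prob_space M by fact
  interpret iid_pairs M A B
    using indep identA identB by unfold_locales
  define \<nu> where "\<nu> = distr M borel (B 0)"
  interpret \<nu>: real_distribution \<nu> unfolding \<nu>_def by (rule real_distribution_distr) measurable
  have gt_eq: "prob {\<omega> \<in> space M. B 0 \<omega> > y} = measure \<nu> {y<..}" for y
    unfolding \<nu>_def by (subst measure_distr) (auto intro!: arg_cong[where f = prob])
  have le_eq: "prob {\<omega> \<in> space M. B 0 \<omega> \<le> y} = measure \<nu> {..y}" for y
    unfolding \<nu>_def by (subst measure_distr) (auto intro!: arg_cong[where f = prob])
  have r_eq: "r y = measure \<nu> {y<..} - C * exp (- b * y)" if "0 \<le> y" for y
    using tail[OF that] by (simp add: gt_eq)
  have r_bound: "\<bar>r y\<bar> \<le> 1 + C" if "0 < y" for y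
  proof -
    have "0 \<le> C * exp (- b * y)" "C * exp (- b * y) \<le> C * 1"
      using C_pos b_pos that by (intro mult_nonneg_nonneg mult_left_mono; simp)+
    then show ?thesis
      using r_eq[of y, OF less_imp_le[OF that]] C_pos \<nu>.prob_le_1[of "{y<..}"] measure_nonneg[of \<nu> "{y<..}"]
      by (intro abs_leI) linarith+
  qed
  \<comment> \<open>Nothing is assumed about \<open>r\<close> at negative arguments; the witness
    \<open>R\<close> agrees with it wherever the integral looks.\<close>
  have right: "set_integrable lborel {0<..} (\<lambda>y. (exp (b * y) - 1) / y * r y)"
    by (rule set_integrable_right_exponent[OF b_pos eps_pos _ _ r_bound r_plus r_minus,
          where R = "\<lambda>y. measure \<nu> {y<..} - C * exp (- b * y)"]) (simp_all add: r_eq)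
  have left: "set_integrable lborel {..<0} (\<lambda>y. (exp (b * y) - 1) / y * measure \<nu> {..y})"
    using logmom by (intro \<nu>.set_integrable_left_exponent b_pos) (simp add: \<nu>_def integrable_distr_eq)
  have compl: "measure \<nu> {y<..} = 1 - measure \<nu> {..y}" for y
    using \<nu>.prob_compl[of "{..y}"] by (simp add: Compl_eq_Diff_UNIV[symmetric])
  \<comment> \<open>On the left \<open>P(B > y) - 1 = - P(B \<le> y)\<close>, which accounts for the
    minus sign between the two integrals in the constant.\<close>
  have defect_eq: "(exp (b * y) - 1) / y * tail_defect \<nu> C b y =
      indicator {0<..} y *\<^sub>R ((exp (b * y) - 1) / y * r y) -
      indicator {..<0} y *\<^sub>R ((exp (b * y) - 1) / y * measure \<nu> {..y})" for y
    by (auto simp: tail_defect_def r_eq compl split: split_indicator)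
  have B: "exponential_tail \<nu> C b"
  proof unfold_locales
    have "((\<lambda>y. C + exp (b * y) * r y) \<longlongrightarrow> C + 0) at_top"
      by (intro tendsto_add tendsto_const r_lim)
    moreover have "\<forall>\<^sub>F y in at_top. C + exp (b * y) * r y = exp (b * y) * measure \<nu> {y<..}"
      using eventually_ge_at_top[of 0]
      by eventually_elim (simp add: r_eq right_diff_distrib exp_minus field_simps)
    ultimately show "((\<lambda>y. exp (b * y) * measure \<nu> {y<..}) \<longlongrightarrow> C) at_top"
      by (simp add: Lim_transform_eventually)
    show "integrable lborel (\<lambda>y. (exp (b * y) - 1) / y * tail_defect \<nu> C b y)"
      unfolding defect_eq using right left unfolding set_integrable_def
      by (rule Bochner_Integration.integrable_diff)
  qed (use C_pos b_pos in auto)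
  interpret B: exponential_tail \<nu> C b by (rule B)
  have exponent_eq: "B.defect_exponent b = (LINT y:{0<..}|lborel. (exp (b * y) - 1) / y * r y)
      - (LINT y:{..<0}|lborel. (exp (b * y) - 1) / y * measure \<nu> {..y})"
    unfolding B.defect_exponent_def defect_eq set_lebesgue_integral_def
    using right left unfolding set_integrable_def by (rule Bochner_Integration.integral_diff)
  \<comment> \<open>The hypothesis controls only the negative part. For the positive part
    \<open>ln (1 + x) \<le> x \<le> exp (b / 2 * x) / (b / 2)\<close>, and the exponential moment at
    \<open>b / 2\<close> is finite.\<close>
  have "integrable M (\<lambda>\<omega>. ln (1 + \<bar>B 0 \<omega>\<bar>))"
  proof (rule Bochner_Integration.integrable_bound)
    have "integrable M (\<lambda>\<omega>. exp (b / 2 * B 0 \<omega>))"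
      using B.mgf_eq(2)[of "b / 2"] b_pos by (simp add: \<nu>_def integrable_distr_eq)
    then show "integrable M (\<lambda>\<omega>. ln (1 + max 0 (- B 0 \<omega>)) + exp (b / 2 * B 0 \<omega>) / (b / 2))"
      using logmom by (intro Bochner_Integration.integrable_add integrable_divide) auto
    show "AE \<omega> in M. norm (ln (1 + \<bar>B 0 \<omega>\<bar>)) \<le> norm (ln (1 + max 0 (- B 0 \<omega>)) + exp (b / 2 * B 0 \<omega>) / (b / 2))"
    proof (rule AE_I2)
      fix \<omega>
      have "ln (1 + \<bar>x\<bar>) \<le> ln (1 + max 0 (- x)) + exp (b / 2 * x) / (b / 2)" for x :: real
      proof (cases "x \<ge> 0")
        case True
        have "ln (1 + \<bar>x\<bar>) \<le> x" using True ln_add_one_self_le_self[of x] by simp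
        also have "\<dots> = (b / 2 * x) / (b / 2)" using b_pos by simp
        also have "\<dots> \<le> exp (b / 2 * x) / (b / 2)"
        proof (rule divide_right_mono)
          show "b / 2 * x \<le> exp (b / 2 * x)"
            using exp_ge_add_one_self[of "b / 2 * x"] by linarith
        qed (use b_pos in simp)
        finally show ?thesis using True by simp
      next
        case False
        then show ?thesis using b_pos by simp
      qed
      moreover have "0 \<le> ln (1 + \<bar>B 0 \<omega>\<bar>)" by simp
      ultimately show "norm (ln (1 + \<bar>B 0 \<omega>\<bar>)) \<le> norm (ln (1 + max 0 (- B 0 \<omega>)) + exp (b / 2 * B 0 \<omega>) / (b / 2))"
        by (smt (verit) real_norm_def)
    qed
  qed measurable
  then interpret beta_pairs M A B lam
    using lam_pos betaA by unfold_locales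
  have "((\<lambda>x. prob {\<omega> \<in> space M. perpetuity A B \<omega> > x} / (x powr (lam * C) * exp (- b * x)))
      \<longlongrightarrow> C * (b powr (lam * C) * exp (lam * B.defect_exponent b) / Gamma (lam * C + 1))) at_top"
    using perpetuity_tail_limit B unfolding \<nu>_def by blast
  \<comment> \<open>A nonzero limit of the quotient is what turns it into asymptotic
    equivalence.\<close>
  moreover have "C * (b powr (lam * C) * exp (lam * B.defect_exponent b) / Gamma (lam * C + 1)) > 0"
    using C_pos lam_pos b_pos by (intro mult_pos_pos divide_pos_pos Gamma_real_pos) (auto intro: add_pos_pos)
  ultimately have "(\<lambda>x. prob {\<omega> \<in> space M. perpetuity A B \<omega> > x}) \<sim>[at_top]
      (\<lambda>x. C * (b powr (lam * C) * exp (lam * B.defect_exponent b) / Gamma (lam * C + 1))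
         * (x powr (lam * C) * exp (- b * x)))"
    by (intro asymp_equivI'_const) auto
  then show ?thesis
    using left right by (simp add: le_eq exponent_eq mult_ac)
qed

end
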